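(* Let $\lambda^\ast$ be the unique positive real number satisfying \[\int_0^1 \frac{e^{-\lambda^\ast/x}}{1+e^{-\lambda^\ast/x}}\cdot\frac{dx}{x} = 1.\] For a positive integer $N$, let \[\mathcal{A} = \mathcal{A}_N := \Big\{S\subseteq [1,N] : \sum_{s\in S}\frac1s = 1\Big\}.\] Then for $\gamma^\ast := \lambda^\ast + \int_0^1 \log(1+e^{-\lambda^\ast/x})\,dx$, we have \[e^{\gamma^\ast N - o(N)} \le |\mathcal{A}| \le e^{\gamma^\ast N + o(N)}.\]
   Context: $[1,N]$ denotes the set of integers $\{1,\dots,N\}$, so $\mathcal{A}$ is a family of sets of integers. $\log$ is the natural logarithm. The notation $o(N)$ refers to the limit $N\to\infty$. *)

theory Defs
  imports "HOL-Analysis.Analysis" "HOL-Library.Landau_Symbols"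
begin

text \<open>
  The integrands below are only meant for \<open>0 < x \<le> 1\<close>; their values at the endpoint \<open>x = 0\<close>,
  where HOL's convention \<open>a / 0 = 0\<close> applies, do not affect the integrals. A non-integrable
  function has integral \<open>0\<close>, so the equation entails convergence of the integral.
\<close>

definition is_lambda_star :: "real \<Rightarrow> bool" where
  "is_lambda_star l \<longleftrightarrow> l > 0 \<and>
     integral {0..1} (\<lambda>x::real. exp (- l / x) / (1 + exp (- l / x)) * (1 / x)) = 1"

text \<open>Meaningful only if exactly one such number exists; the theorem asserts this as well.\<close>

definition lambda_star :: real where
  "lambda_star = (THE l. is_lambda_star l)"

definition gamma_star :: real where
  "gamma_star = lambda_star + integral {0..1} (\<lambda>x::real. ln (1 + exp (- lambda_star / x)))"

definition unit_fraction_sets :: "nat \<Rightarrow> nat set set" where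
  "unit_fraction_sets N = {S. S \<subseteq> {1..N} \<and> (\<Sum>s\<in>S. 1 / real s) = 1}"

end

theory Submission
  imports Defs "HOL-Number_Theory.Cong" "HOL-Computational_Algebra.Primes" "HOL-Real_Asymp.Real_Asymp"
begin

text \<open>
  Give a set \<open>S\<close> of integers in \<open>[1,N]\<close> the weight \<open>exp (- l N (\<Sum>s\<in>S. 1/s))\<close>. The total weight
  is \<open>\<Prod>n\<le>N. 1 + exp (- l N / n)\<close>, whose logarithm divided by \<open>N\<close> is a Riemann sum of \<open>\<integral> log (1
  + exp (- l / x)) dx\<close>. Every set with reciprocal sum \<open>1\<close> has weight \<open>exp (- l N)\<close>, which is
  the upper bound, for any \<open>l > 0\<close> (\<open>log_card_unit_fraction_sets_upper\<close>).

  For the lower bound, choose \<open>S\<close> at random with probability proportional to its weight, that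
  is, include each \<open>n\<close> independently with probability \<open>w / (1 + w)\<close>, \<open>w = exp (- l N / n)\<close>. The
  expected reciprocal sum is a Riemann sum of the integral that defines \<open>\<lambda>\<^sup>*\<close>, so for \<open>l = \<lambda>\<^sup>*\<close>
  it tends to \<open>1\<close>; the variance is \<open>O(1/N)\<close>. Chebyshev's inequality then gives \<open>exp (\<gamma>\<^sup>* N -
  o(N))\<close> sets with reciprocal sum close to \<open>1\<close> (\<open>card_subsets_with_sum_near_mean\<close>). What
  remains is to turn a sum slightly below \<open>1\<close> into exactly \<open>1\<close> without losing count.

  This is done by reserving a small set of integers for corrections. For every \<open>\<kappa> > 0\<close> and
  large \<open>N\<close> there is a set \<open>B\<close> that omits at most \<open>\<kappa> N\<close> of the integers up to \<open>N\<close> and such that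
  every \<open>S \<subseteq> B\<close> with sum at most \<open>1 - \<kappa>\<close> can be completed to sum \<open>1\<close> by integers outside \<open>B\<close>
  (\<open>eventually_completable_set\<close>). As \<open>S\<close> is the part of the completed set in \<open>B\<close>, completion is
  injective, so almost all freedom is kept.

  To build \<open>B\<close>, let \<open>r\<close> run through the \<open>k\<close> odd primes up to a constant \<open>z\<close>, let \<open>2^J\<close> be about
  \<open>N^(1/K)\<close> for a large constant \<open>K\<close>, let \<open>q\<^sub>r\<close> be the largest power of \<open>r\<close> up to \<open>2^J\<close>, and
  put \<open>Y = \<Prod>r. q\<^sub>r\<close>, \<open>M = 2^J Y\<close>. By the Chinese remainder theorem and binary expansion, every
  fraction \<open>n / M\<close> with \<open>k Y \<le> n \<le> M\<close> is a sum of distinct unit fractions whose denominators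
  are \<open>2^j\<close> or \<open>2^j q\<^sub>r\<close>, all at most \<open>4^J\<close> (\<open>egyptian_fraction_in_base\<close>). With \<open>k \<ge> K\<close> the
  number \<open>Y\<close> is at least \<open>X \<approx> N / 4^J\<close>, so for every prime \<open>p\<close> with \<open>z < p \<le> X\<close> these \<open>n\<close> hit all
  residues modulo \<open>p\<close>. Subtracting a suitable \<open>n / (p M)\<close> therefore removes the prime \<open>p\<close> from
  a denominator, at the cost of distinct unit fractions with denominators \<open>p m \<le> X 4^J \<le> N\<close>.
  Once all these primes are removed, what is left is \<open>n / M\<close>, which is representable as well
  (\<open>egyptian_fraction_clearing_primes\<close>). Finally, \<open>B\<close> consists of the divisors of \<open>M \<Prod>p\<close> up to
  \<open>N\<close> that are not of these reserved forms. The reserved integers are few. The remaining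
  integers outside \<open>B\<close> have a large square divisor, a large power of a small prime, or a prime
  factor above \<open>X\<close>; by a Chebyshev bound for the number of primes in dyadic intervals the last
  kind has density \<open>O(1/K)\<close>.
\<close>

section \<open>The two integrands and the number \<open>\<lambda>\<^sup>*\<close>\<close>

lemma exp_minus_le_square:
  fixes y :: real assumes "y > 0" shows "exp (- y) \<le> 2 / y\<^sup>2"
proof -
  have "y\<^sup>2 / 2 \<le> exp y"
    using exp_lower_Taylor_quadratic[of y] assms by simp
  then show ?thesis
    using assms by (simp add: exp_minus field_simps)
qed

definition reciprocal_density :: "real \<Rightarrow> real \<Rightarrow> real" where
  "reciprocal_density l x = exp (- l / x) / (1 + exp (- l / x)) * (1 / x)"

text \<open>
  The value \<open>0\<close> at the origin makes this function continuous on the closed unit interval, whereas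
  \<open>ln (1 + exp (- l / 0))\<close> is \<open>ln 2\<close>. The integral is the same.
\<close>

definition log_partition :: "real \<Rightarrow> real \<Rightarrow> real" where
  "log_partition l x = (if x = 0 then 0 else ln (1 + exp (- l / x)))"

lemma reciprocal_density_nonneg: "0 \<le> x \<Longrightarrow> 0 \<le> reciprocal_density l x"
  unfolding reciprocal_density_def by (intro mult_nonneg_nonneg divide_nonneg_nonneg) (auto intro: add_nonneg_nonneg)

lemma reciprocal_density_le_exp:
  assumes "0 \<le> x" shows "reciprocal_density l x \<le> exp (- l / x) * (1 / x)"
  unfolding reciprocal_density_def
proof (rule mult_right_mono)
  show "exp (- l / x) / (1 + exp (- l / x)) \<le> exp (- l / x)"
    by (simp add: divide_le_eq add_pos_pos algebra_simps)
qed (use assms in auto)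

lemma exp_over_le:
  fixes l x :: real
  assumes "0 < l" "0 < x" shows "exp (- l / x) \<le> 2 * x\<^sup>2 / l\<^sup>2"
  using exp_minus_le_square[of "l / x"] assms by (simp add: power_divide)

lemma reciprocal_density_le_linear:
  assumes "0 < l" "0 \<le> x" shows "reciprocal_density l x \<le> 2 * x / l\<^sup>2"
proof (cases "x = 0")
  case False
  then have "x > 0" using assms by simp
  have "reciprocal_density l x \<le> exp (- l / x) * (1 / x)"
    using assms(2) by (rule reciprocal_density_le_exp)
  also have "\<dots> \<le> 2 * x\<^sup>2 / l\<^sup>2 * (1 / x)"
    using exp_over_le[OF assms(1) \<open>x > 0\<close>] \<open>x > 0\<close> by (intro mult_right_mono) auto
  also have "\<dots> = 2 * x / l\<^sup>2" using \<open>x > 0\<close> by (simp add: power2_eq_square)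
  finally show ?thesis .
qed (simp add: reciprocal_density_def)

lemma reciprocal_density_le_inverse:
  assumes "0 < l" "0 \<le> x" shows "reciprocal_density l x \<le> 1 / l"
proof (cases "x = 0")
  case False
  have "reciprocal_density l x \<le> exp (- l / x) * (1 / x)"
    using assms(2) by (rule reciprocal_density_le_exp)
  also have "\<dots> \<le> 1 / l"
  proof -
    have "l / x \<le> exp (l / x)" using exp_ge_add_one_self[of "l / x"] by linarith
    then show ?thesis using False assms by (simp add: exp_minus field_simps)
  qed
  finally show ?thesis .
qed (use assms in \<open>simp add: reciprocal_density_def\<close>)

text \<open>
  Both integrands are smooth away from the origin and bounded by a multiple of \<open>x\<close>; this is all that
  their continuity at the origin needs.
\<close>

lemma continuous_on_unit_interval_if_linear_bound:
  fixes f :: "real \<Rightarrow> real"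
  assumes "\<And>x. x \<in> {0<..1} \<Longrightarrow> isCont f x"
    and "f 0 = 0" and "\<And>x. x \<in> {0..1} \<Longrightarrow> \<bar>f x\<bar> \<le> C * x"
  shows "continuous_on {0..1} f"
  unfolding continuous_on_eq_continuous_within
proof
  fix x :: real assume x: "x \<in> {0..1}"
  show "continuous (at x within {0..1}) f"
  proof (cases "x = 0")
    case True
    have "(f \<longlongrightarrow> 0) (at 0 within {0..1})"
    proof (rule Lim_null_comparison)
      show "\<forall>\<^sub>F x in at 0 within {0..1}. norm (f x) \<le> C * x"
        using assms(3) by (auto simp: eventually_at_filter)
      show "((\<lambda>x. C * x) \<longlongrightarrow> 0) (at 0 within {0..1})"
        by (auto intro!: tendsto_eq_intros)
    qed
    then show ?thesis using True assms(2) by (simp add: continuous_within)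
  next
    case False
    then show ?thesis using assms(1)[of x] x by (auto intro: continuous_at_imp_continuous_at_within)
  qed
qed

lemma continuous_on_reciprocal_density:
  assumes "0 < l" shows "continuous_on {0..1} (reciprocal_density l)"
proof (rule continuous_on_unit_interval_if_linear_bound)
  fix x :: real assume "x \<in> {0<..1}"
  moreover have "1 + exp (- l / x) \<noteq> 0" by (metis add_pos_pos exp_gt_zero less_irrefl zero_less_one)
  ultimately show "isCont (reciprocal_density l) x"
    unfolding reciprocal_density_def by (intro continuous_intros) auto
next
  fix x :: real assume "x \<in> {0..1}"
  then show "\<bar>reciprocal_density l x\<bar> \<le> (2 / l\<^sup>2) * x"
    using reciprocal_density_nonneg[of x l] reciprocal_density_le_linear[OF assms, of x] by simp
qed (simp add: reciprocal_density_def)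

lemma continuous_on_log_partition:
  assumes "0 < l" shows "continuous_on {0..1} (log_partition l)"
proof (rule continuous_on_unit_interval_if_linear_bound)
  fix x :: real assume x: "x \<in> {0<..1}"
  have "1 + exp (- l / x) > 0" by (intro add_pos_pos) auto
  then have "isCont (\<lambda>x. ln (1 + exp (- l / x))) x"
    using x by (intro continuous_intros) auto
  moreover have "\<forall>\<^sub>F y in nhds x. ln (1 + exp (- l / y)) = log_partition l y"
    using x eventually_mono[OF t1_space_nhds[of x 0]] by (auto simp: log_partition_def)
  ultimately show "isCont (log_partition l) x"
    using isCont_cong[of "\<lambda>x. ln (1 + exp (- l / x))" "log_partition l" x] by simp
next
  fix x :: real assume x: "x \<in> {0..1}"
  show "\<bar>log_partition l x\<bar> \<le> (2 / l\<^sup>2) * x"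
  proof (cases "x = 0")
    case False
    then have "x > 0" using x by simp
    have "ln (1 + exp (- l / x)) \<le> exp (- l / x)" by (rule ln_add_one_self_le_self) simp
    also have "\<dots> \<le> 2 * x\<^sup>2 / l\<^sup>2" by (rule exp_over_le[OF assms \<open>x > 0\<close>])
    also have "\<dots> \<le> (2 / l\<^sup>2) * x"
      using x \<open>x > 0\<close> by (simp add: power2_eq_square divide_right_mono mult_left_le)
    finally show ?thesis using False by (simp add: log_partition_def)
  qed (simp add: log_partition_def)
qed (simp add: log_partition_def)

lemma integral_log_partition:
  "integral {0..1} (\<lambda>x. ln (1 + exp (- l / x))) = integral {0..1} (log_partition l)"
  by (rule integral_spike[of "{0}"]) (auto simp: log_partition_def)

text \<open>
  For fixed \<open>x\<close> the density decreases in \<open>l\<close>, with a Lipschitz constant that does not depend on \<open>x\<close>.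
  Monotonicity yields uniqueness of \<open>\<lambda>\<^sup>*\<close>, the Lipschitz bound continuity of the integral in \<open>l\<close>.
\<close>

lemma reciprocal_density_diff:
  assumes "0 < l" "l \<le> l'" "0 \<le> x"
  shows "0 \<le> reciprocal_density l x - reciprocal_density l' x"
    and "reciprocal_density l x - reciprocal_density l' x \<le> (l' - l) * (2 / l\<^sup>2)"
proof -
  define s t where "s = exp (- l / x)" and "t = exp (- l' / x)"
  have pos: "s > 0" "t > 0" by (auto simp: s_def t_def)
  have ts: "t \<le> s" using assms by (simp add: s_def t_def divide_right_mono)
  have eq: "reciprocal_density l x - reciprocal_density l' x = (s - t) / ((1 + s) * (1 + t)) * (1 / x)"
  proof -
    have "1 + s \<noteq> 0" "1 + t \<noteq> 0" using pos by auto
    then have "s / (1 + s) - t / (1 + t) = (s - t) / ((1 + s) * (1 + t))"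
      by (simp add: diff_frac_eq) (simp add: algebra_simps)
    then show ?thesis
      unfolding reciprocal_density_def s_def[symmetric] t_def[symmetric] left_diff_distrib[symmetric]
      by simp
  qed
  show "0 \<le> reciprocal_density l x - reciprocal_density l' x"
    unfolding eq using pos ts assms by (intro mult_nonneg_nonneg divide_nonneg_nonneg) auto
  show "reciprocal_density l x - reciprocal_density l' x \<le> (l' - l) * (2 / l\<^sup>2)"
  proof (cases "x = 0")
    case False
    then have "x > 0" using assms by simp
    have "(s - t) / ((1 + s) * (1 + t)) \<le> s - t"
    proof -
      have "1 * 1 \<le> (1 + s) * (1 + t)" using pos by (intro mult_mono) auto
      then show ?thesis using ts pos by (simp add: divide_le_eq mult_le_cancel_left1)
    qed
    also have "s - t = s * (1 - exp (- ((l' - l) / x)))"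
      by (simp add: s_def t_def right_diff_distrib exp_add[symmetric] add_divide_distrib diff_divide_distrib)
    also have "\<dots> \<le> s * ((l' - l) / x)"
      using pos exp_ge_add_one_self[of "- ((l' - l) / x)"] by (intro mult_left_mono) auto
    also have "\<dots> \<le> (2 * x\<^sup>2 / l\<^sup>2) * ((l' - l) / x)"
      using exp_over_le[OF assms(1) \<open>x > 0\<close>] assms unfolding s_def by (intro mult_right_mono) auto
    finally have "(s - t) / ((1 + s) * (1 + t)) * (1 / x) \<le> (2 * x\<^sup>2 / l\<^sup>2) * ((l' - l) / x) * (1 / x)"
      using \<open>x > 0\<close> by (intro mult_right_mono) auto
    also have "\<dots> = (l' - l) * (2 / l\<^sup>2)"
      using \<open>x > 0\<close> by (simp add: power2_eq_square)
    finally show ?thesis unfolding eq .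
  qed (use assms in \<open>auto simp: reciprocal_density_def\<close>)
qed

text \<open>
  The integral is a continuous, strictly decreasing function of \<open>l\<close>. It is at most \<open>1\<close> at \<open>l = 1\<close>,
  where the density is bounded by \<open>1\<close>. For \<open>x \<ge> l\<close> the density is at least \<open>1 / ((1 + e) x)\<close>, so that
  the integral is at least \<open>log (1 / l) / (1 + e)\<close>, and this is \<open>4 / (1 + e) \<ge> 1\<close> for \<open>l = exp (-4)\<close>.
\<close>

lemma ex1_lambda_star: "\<exists>!l. is_lambda_star l"
proof -
  define G where "G l = integral {0..1} (reciprocal_density l)" for l
  have star: "is_lambda_star l \<longleftrightarrow> l > 0 \<and> G l = 1" for l
    by (simp add: is_lambda_star_def G_def reciprocal_density_def[abs_def])
  have int: "reciprocal_density l integrable_on {0..1}" if "l > 0" for l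
    using integrable_continuous_real[OF continuous_on_reciprocal_density[OF that]] .
  have diff: "G l - G l' = integral {0..1} (\<lambda>x. reciprocal_density l x - reciprocal_density l' x)"
    if "0 < l" "0 < l'" for l l'
    unfolding G_def using int that by (simp add: integral_diff)
  have lip: "\<bar>G l - G l'\<bar> \<le> (l' - l) * (2 / l\<^sup>2)" if "0 < l" "l \<le> l'" for l l'
  proof -
    have "norm (integral {0..1} (\<lambda>x. reciprocal_density l x - reciprocal_density l' x)) \<le> (l' - l) * (2 / l\<^sup>2) * (1 - 0)"
    proof (rule integral_bound)
      show "continuous_on {0..1} (\<lambda>x. reciprocal_density l x - reciprocal_density l' x)"
        using that by (intro continuous_intros continuous_on_reciprocal_density) auto
      show "norm (reciprocal_density l x - reciprocal_density l' x) \<le> (l' - l) * (2 / l\<^sup>2)"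
        if "x \<in> {0..1}" for x
        using reciprocal_density_diff[OF \<open>0 < l\<close> \<open>l \<le> l'\<close>, of x] that by auto
    qed auto
    then show ?thesis using diff[of l l'] that by simp
  qed
  have cont: "continuous_on {a..b} G" if "0 < a" for a b
  proof (rule lipschitz_on_continuous_on[of "2 / a\<^sup>2"], rule lipschitz_onI)
    have le: "\<bar>G l - G l'\<bar> \<le> 2 / a\<^sup>2 * \<bar>l - l'\<bar>" if "a \<le> l" "l \<le> l'" for l l'
    proof -
      have "\<bar>G l - G l'\<bar> \<le> (l' - l) * (2 / l\<^sup>2)" using lip[of l l'] that \<open>0 < a\<close> by simp
      also have "\<dots> \<le> (l' - l) * (2 / a\<^sup>2)"
        using that \<open>0 < a\<close> by (intro mult_left_mono divide_left_mono power_mono) auto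
      finally show ?thesis using that by (simp add: mult.commute)
    qed
    show "dist (G x) (G y) \<le> 2 / a\<^sup>2 * dist x y" if "x \<in> {a..b}" "y \<in> {a..b}" for x y
    proof (cases "x \<le> y")
      case True then show ?thesis using le[of x y] that by (simp add: dist_real_def)
    next
      case False then show ?thesis using le[of y x] that by (simp add: dist_real_def abs_minus_commute)
    qed
  qed auto
  have upper: "G 1 \<le> 1"
  proof -
    have "G 1 \<le> integral {0..1} (\<lambda>x::real. 1 :: real)"
      unfolding G_def
    proof (rule integral_le)
      fix x :: real assume "x \<in> {0..1}"
      then show "reciprocal_density 1 x \<le> 1" using reciprocal_density_le_inverse[of 1 x] by simp
    qed (auto intro: int)
    then show ?thesis by simp
  qed
  define a :: real where "a = exp (- 4)"
  have a: "0 < a" "a \<le> 1" by (auto simp: a_def)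
  have lower: "1 \<le> G a"
  proof -
    have e1: "1 + exp 1 \<noteq> (0::real)" by (metis add_pos_pos exp_gt_zero less_irrefl zero_less_one)
    have ln_int: "((\<lambda>x. 1 / (1 + exp 1) * (1 / x)) has_integral (1 / (1 + exp 1) * ln 1 - 1 / (1 + exp 1) * ln a)) {a..1}"
      using a e1 by (intro fundamental_theorem_of_calculus)
        (auto intro!: derivative_eq_intros simp flip: has_real_derivative_iff_has_vector_derivative)
    have "1 + exp 1 \<le> (4::real)" using exp_le by simp
    then have "1 \<le> 4 / (1 + exp (1::real))" by (simp add: le_divide_eq add_pos_pos)
    also have "4 / (1 + exp (1::real)) = integral {a..1} (\<lambda>x. 1 / (1 + exp 1) * (1 / x))"
      using integral_unique[OF ln_int] by (simp add: a_def)
    also have "\<dots> \<le> integral {a..1} (reciprocal_density a)"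
    proof (rule integral_le)
      show "reciprocal_density a integrable_on {a..1}"
        using integrable_on_subinterval[OF int[OF a(1)], of a 1] a by auto
      fix x :: real assume x: "x \<in> {a..1}"
      have "exp (- a / x) / (1 + exp (- a / x)) = 1 / (1 + exp (a / x))"
        using add_pos_pos[of 1 "exp (a / x)"] add_pos_pos[of 1 "exp (- a / x)"]
        by (simp add: exp_minus field_simps)
      moreover have "exp (a / x) \<le> exp 1" using x a by simp
      ultimately have "1 / (1 + exp 1) \<le> exp (- a / x) / (1 + exp (- a / x))"
        by (simp add: frac_le add_pos_pos)
      then show "1 / (1 + exp 1) * (1 / x) \<le> reciprocal_density a x"
        using x a unfolding reciprocal_density_def by (intro mult_right_mono) auto
    qed (use ln_int in \<open>auto simp: integrable_on_def\<close>)
    also have "\<dots> \<le> G a" unfolding G_def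
    proof (rule integral_subset_le)
      show "reciprocal_density a integrable_on {a..1}"
        using integrable_on_subinterval[OF int[OF a(1)], of a 1] a by auto
    qed (use a int reciprocal_density_nonneg in auto)
    finally show ?thesis .
  qed
  obtain l where l: "a \<le> l" "l \<le> 1" "G l = 1"
    using IVT2'[OF upper lower a(2) cont[OF a(1)]] by blast
  have strict: "G l' < G l" if "0 < l" "l < l'" for l l'
  proof (rule ccontr)
    define d where "d x = reciprocal_density l x - reciprocal_density l' x" for x
    assume "\<not> G l' < G l"
    moreover have dc: "continuous_on {0..1} d"
      unfolding d_def using that by (intro continuous_intros continuous_on_reciprocal_density) auto
    moreover have dn: "0 \<le> d x" if "x \<in> {0..1}" for x
      unfolding d_def using reciprocal_density_diff(1)[of l l' x] that \<open>0 < l\<close> \<open>l < l'\<close> by auto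
    moreover have Gd: "G l - G l' = integral {0..1} d"
      using diff[of l l'] that unfolding d_def by auto
    ultimately have "integral {0..1} d = 0"
      using integral_nonneg[of d "{0..1}"] integrable_continuous_real[OF dc] by simp
    then have "(d has_integral 0) {0..1}"
      using integrable_continuous_real[OF dc] by (simp add: has_integral_integrable_integral)
    then have "d 1 = 0"
      using has_integral_0_cbox_imp_0[of 0 1 d 1] dc dn by auto
    then have "exp (- l) * (1 + exp (- l')) = exp (- l') * (1 + exp (- l))"
      using add_pos_pos[of 1 "exp (- l)"] add_pos_pos[of 1 "exp (- l')"]
      by (simp add: d_def reciprocal_density_def frac_eq_eq)
    then show False using that by (simp add: algebra_simps)
  qed
  show ?thesis
  proof (rule ex1I[of _ l])
    show "is_lambda_star l" using l a by (simp add: star)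
    fix l' assume "is_lambda_star l'"
    then show "l' = l" using strict[of l l'] strict[of l' l] l a unfolding star
      by (cases l l' rule: linorder_cases) auto
  qed
qed

section \<open>Riemann sums\<close>

lemma riemann_sum_tendsto_integral:
  fixes f :: "real \<Rightarrow> real"
  assumes cont: "continuous_on {0..1} f"
  shows "(\<lambda>N. (\<Sum>n=1..N. f (real n / real N)) / real N) \<longlonglongrightarrow> integral {0..1} f"
proof (rule LIMSEQ_I)
  fix e :: real assume "e > 0"
  have "uniformly_continuous_on {0..1} f" using cont by (intro compact_uniformly_continuous) auto
  then obtain d where d: "d > 0"
    "\<And>x y. x \<in> {0..1} \<Longrightarrow> y \<in> {0..1} \<Longrightarrow> dist y x < d \<Longrightarrow> dist (f y) (f x) < e / 2"
    unfolding uniformly_continuous_on_def using \<open>e > 0\<close> by (metis half_gt_zero)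
  obtain N0 where N0: "real N0 > 1 / d" using reals_Archimedean2 by blast
  show "\<exists>N0. \<forall>N\<ge>N0. norm ((\<Sum>n=1..N. f (real n / real N)) / real N - integral {0..1} f) < e"
  proof (intro exI allI impI)
    fix N assume N: "N \<ge> max N0 1"
    then have "1 / d < real N" using N0 by linarith
    then have Nd: "1 / real N < d" using d(1) N by (simp add: field_simps)
    have int: "f integrable_on {a..b}" if "0 \<le> a" "b \<le> 1" for a b
      using integrable_on_subinterval[OF integrable_continuous_real[OF cont]] that by auto
    have step: "\<bar>f (real (Suc n) / N) / N - integral {n / N..real (Suc n) / N} f\<bar> \<le> e / 2 / N" if "n < N" for n
    proof -
      let ?a = "real n / N" and ?b = "real (Suc n) / N"
      have ab: "0 \<le> ?a" "?a \<le> ?b" "?b \<le> 1" "?b - ?a = 1 / N"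
        using that by (auto simp: divide_right_mono field_simps)
      have "norm (integral {?a..?b} (\<lambda>x. f ?b - f x)) \<le> e / 2 * (?b - ?a)"
      proof (rule integral_bound)
        show "continuous_on {?a..?b} (\<lambda>x. f ?b - f x)"
          using ab by (intro continuous_intros continuous_on_subset[OF cont]) auto
        fix x assume x: "x \<in> {?a..?b}"
        then have "dist ?b x < d" using ab Nd by (simp add: dist_real_def)
        moreover have "x \<in> {0..1}" "?b \<in> {0..1}" using x ab by (meson atLeastAtMost_iff order.trans)+
        ultimately have "dist (f ?b) (f x) < e / 2" using d(2) by blast
        then show "norm (f ?b - f x) \<le> e / 2" by (simp add: dist_norm)
      qed (use ab in auto)
      moreover have "integral {?a..?b} (\<lambda>x. f ?b - f x) = f ?b * (?b - ?a) - integral {?a..?b} f"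
        using ab int[of ?a ?b] by (subst integral_diff) (auto simp: mult.commute)
      ultimately show ?thesis unfolding ab(4) by simp
    qed
    have split: "integral {0..real k / N} f = (\<Sum>n<k. integral {n / N..real (Suc n) / N} f)" if "k \<le> N" for k
      using that
    proof (induction k)
      case (Suc k)
      have "integral {0..k / N} f + integral {k / N..real (Suc k) / N} f = integral {0..real (Suc k) / N} f"
        using Suc.prems by (intro Henstock_Kurzweil_Integration.integral_combine int) (auto simp: divide_right_mono)
      then show ?case using Suc by simp
    qed simp
    have "(\<Sum>n=1..N. f (real n / N)) / N - integral {0..1} f
        = (\<Sum>n<N. f (real (Suc n) / N) / N - integral {n / N..real (Suc n) / N} f)"
      using split[of N] N
      by (simp add: sum_subtractf sum_divide_distrib sum.atLeast1_atMost_eq)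
    also have "\<bar>\<dots>\<bar> \<le> (\<Sum>n<N. e / 2 / N)"
      by (intro order.trans[OF sum_abs] sum_mono step) auto
    also have "\<dots> = e / 2" using N by simp
    finally show "norm ((\<Sum>n=1..N. f (real n / N)) / N - integral {0..1} f) < e"
      using \<open>e > 0\<close> by simp
  qed
qed

text \<open>
  With weights \<open>exp (- l N / n)\<close> the inclusion probabilities and the logarithm of the total weight are
  values of the two integrands at the points \<open>n / N\<close>, which turns the sums below into Riemann sums.
\<close>

lemma tilted_term_eq_density:
  fixes l :: real and n N :: nat
  assumes "1 \<le> n" "1 \<le> N"
  shows "exp (- (l * real N) * (1 / real n)) / (1 + exp (- (l * real N) * (1 / real n))) * (1 / real n)
      = reciprocal_density l (real n / real N) / real N"
    and "ln (1 + exp (- (l * real N) * (1 / real n))) = log_partition l (real n / real N)"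
  using assms by (simp_all add: reciprocal_density_def log_partition_def)

section \<open>Counting subsets with a prescribed sum by exponential weights\<close>

lemma sum_Pow_insert:
  assumes "finite A" "n \<notin> A"
  shows "(\<Sum>S\<in>Pow (insert n A). f S) = (\<Sum>S\<in>Pow A. f S + f (insert n S))"
proof -
  have inj: "inj_on (insert n) (Pow A)" using assms by (auto intro!: inj_onI)
  have "(\<Sum>S\<in>Pow (insert n A). f S) = (\<Sum>S\<in>Pow A. f S) + (\<Sum>S\<in>insert n ` Pow A. f S)"
    unfolding Pow_insert using assms by (intro sum.union_disjoint) auto
  also have "(\<Sum>S\<in>insert n ` Pow A. f S) = (\<Sum>S\<in>Pow A. f (insert n S))"
    using inj by (simp add: sum.reindex)
  finally show ?thesis by (simp add: sum.distrib)
qed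

text \<open>
  The mean and the variance of \<open>\<Sum>n\<in>S. x n\<close> for a random subset \<open>S\<close> of \<open>A\<close> that is chosen with probability
  proportional to \<open>\<Prod>n\<in>S. a n\<close>. Under this law the events \<open>n \<in> S\<close> are independent, with probability
  \<open>a n / (1 + a n)\<close>.
\<close>

definition tilted_mean :: "('a \<Rightarrow> real) \<Rightarrow> ('a \<Rightarrow> real) \<Rightarrow> 'a set \<Rightarrow> real" where
  "tilted_mean a x A = (\<Sum>n\<in>A. a n / (1 + a n) * x n)"

definition tilted_variance :: "('a \<Rightarrow> real) \<Rightarrow> ('a \<Rightarrow> real) \<Rightarrow> 'a set \<Rightarrow> real" where
  "tilted_variance a x A = (\<Sum>n\<in>A. a n / (1 + a n)\<^sup>2 * (x n)\<^sup>2)"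

lemma sum_Pow_prod:
  fixes a :: "'a \<Rightarrow> 'b :: comm_semiring_1"
  assumes "finite A" shows "(\<Sum>S\<in>Pow A. \<Prod>n\<in>S. a n) = (\<Prod>n\<in>A. 1 + a n)"
  using prod_add[OF assms, of a "\<lambda>_. 1"] by (simp add: add.commute)

lemma prod_insert_subset:
  assumes "finite A" "n \<notin> A" "S \<subseteq> A"
  shows "prod a (insert n S) = a n * prod a S" "sum x (insert n S) = x n + sum x S"
  using assms by (metis finite_subset prod.insert subsetD) (metis assms finite_subset sum.insert subsetD)

text \<open>
  The centred second moment, multiplied by the total weight \<open>\<Prod>n\<in>A. 1 + a n\<close>. When \<open>n\<close> is added to the
  ground set, the cross terms from \<open>S\<close> and from \<open>insert n S\<close> cancel, because \<open>n\<close> is included with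
  probability \<open>p = a n / (1 + a n)\<close>, that is, \<open>p * (1 + a n) = a n\<close>.
\<close>

lemma tilted_second_moment:
  fixes a x :: "'a \<Rightarrow> real"
  assumes "finite A" "\<And>n. n \<in> A \<Longrightarrow> 0 \<le> a n"
  shows "(\<Sum>S\<in>Pow A. (\<Prod>n\<in>S. a n) * (sum x S - tilted_mean a x A)\<^sup>2)
      = (\<Prod>n\<in>A. 1 + a n) * tilted_variance a x A"
  using assms
proof (induction A rule: finite_induct)
  case empty
  show ?case by (simp add: tilted_mean_def tilted_variance_def)
next
  case (insert n A)
  let ?m = "tilted_mean a x A" and ?p = "a n / (1 + a n)" and ?V = "tilted_variance a x A"
  let ?w = "\<lambda>S. \<Prod>n\<in>S. a n" and ?Z = "\<Prod>n\<in>A. 1 + a n"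
  have an: "0 \<le> a n" "1 + a n \<noteq> 0" using insert.prems[of n] by auto
  have IH: "(\<Sum>S\<in>Pow A. ?w S * (sum x S - ?m)\<^sup>2) = ?Z * ?V"
    using insert by auto
  have mean: "tilted_mean a x (insert n A) = ?m + ?p * x n"
    and var: "tilted_variance a x (insert n A) = a n / (1 + a n)\<^sup>2 * (x n)\<^sup>2 + ?V"
    using insert.hyps by (auto simp: tilted_mean_def tilted_variance_def)
  have p: "?p * (1 + a n) = a n" using an by simp
  have "(\<Sum>S\<in>Pow (insert n A). ?w S * (sum x S - tilted_mean a x (insert n A))\<^sup>2)
      = (\<Sum>S\<in>Pow A. (1 + a n) * (?w S * (sum x S - ?m)\<^sup>2) + ?p * (x n)\<^sup>2 * ?w S)"
    unfolding sum_Pow_insert[OF insert.hyps] mean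
  proof (rule sum.cong[OF refl])
    fix S assume "S \<in> Pow A"
    then have S: "prod a (insert n S) = a n * prod a S" "sum x (insert n S) = x n + sum x S"
      using prod_insert_subset[OF insert.hyps] by auto
    have "prod a S * (sum x S - (?m + ?p * x n))\<^sup>2 + prod a (insert n S) * (sum x (insert n S) - (?m + ?p * x n))\<^sup>2
      = (1 + a n) * (prod a S * (sum x S - ?m)\<^sup>2) + ?p * (x n)\<^sup>2 * prod a S
        + prod a S * (2 * x n * (sum x S - ?m) * (a n - ?p * (1 + a n))
          + (x n)\<^sup>2 * (a n - ?p * (1 + a n)) * (1 - ?p))"
      unfolding S by algebra
    then show "prod a S * (sum x S - (?m + ?p * x n))\<^sup>2 + prod a (insert n S) * (sum x (insert n S) - (?m + ?p * x n))\<^sup>2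
      = (1 + a n) * (prod a S * (sum x S - ?m)\<^sup>2) + ?p * (x n)\<^sup>2 * prod a S" unfolding p by simp
  qed
  also have "\<dots> = (1 + a n) * (?Z * ?V) + ?p * (x n)\<^sup>2 * ?Z"
    unfolding sum.distrib sum_distrib_left[symmetric] IH sum_Pow_prod[OF insert.hyps(1)] ..
  also have "\<dots> = (1 + a n) * ?Z * (a n / (1 + a n)\<^sup>2 * (x n)\<^sup>2 + ?V)"
  proof -
    have "?p * (x n)\<^sup>2 = (1 + a n) * (a n / (1 + a n)\<^sup>2 * (x n)\<^sup>2)"
      using an by (simp add: power2_eq_square)
    then show ?thesis by (simp only: distrib_left mult_ac add_ac)
  qed
  also have "\<dots> = (\<Prod>n\<in>insert n A. 1 + a n) * tilted_variance a x (insert n A)"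
    unfolding var using insert.hyps by simp
  finally show ?case .
qed

text \<open>
  By Chebyshev's inequality the sets with sum within \<open>d\<close> of the mean carry the stated part of the
  total weight, and each of them has weight at most \<open>exp (- t (mean - d))\<close>.
\<close>

lemma card_subsets_with_sum_near_mean:
  fixes x :: "'a \<Rightarrow> real" and t d :: real
  defines "a \<equiv> \<lambda>n. exp (- t * x n)"
  assumes "finite A" "0 \<le> t" "0 < d"
  shows "(\<Prod>n\<in>A. 1 + a n) * (1 - tilted_variance a x A / d\<^sup>2) * exp (t * (tilted_mean a x A - d))
    \<le> real (card {S. S \<subseteq> A \<and> \<bar>sum x S - tilted_mean a x A\<bar> < d})"
proof -
  let ?m = "tilted_mean a x A" and ?V = "tilted_variance a x A"
  let ?w = "\<lambda>S. \<Prod>n\<in>S. a n" and ?Z = "\<Prod>n\<in>A. 1 + a n"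
  define I where "I = {S. S \<subseteq> A \<and> \<bar>sum x S - ?m\<bar> < d}"
  have I: "I \<subseteq> Pow A" by (auto simp: I_def)
  have fin: "finite (Pow A)" "finite I" using assms I by (auto intro: finite_subset)
  have a0: "0 \<le> a n" for n by (simp add: a_def)
  have w0: "0 \<le> ?w S" for S by (intro prod_nonneg a0)
  have w: "?w S = exp (- t * sum x S)" if "S \<subseteq> A" for S
    using that assms(2) by (simp add: a_def exp_sum[symmetric] sum_distrib_left finite_subset sum_negf)
  have "(\<Sum>S\<in>Pow A - I. ?w S) \<le> (\<Sum>S\<in>Pow A - I. ?w S * (sum x S - ?m)\<^sup>2 / d\<^sup>2)"
  proof (rule sum_mono)
    fix S assume "S \<in> Pow A - I"
    then have "d \<le> \<bar>sum x S - ?m\<bar>" by (auto simp: I_def)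
    then have "d\<^sup>2 \<le> (sum x S - ?m)\<^sup>2" using assms(4) by (metis abs_le_square_iff abs_of_pos)
    then have "?w S * d\<^sup>2 \<le> ?w S * (sum x S - ?m)\<^sup>2" using w0 by (intro mult_left_mono) auto
    then show "?w S \<le> ?w S * (sum x S - ?m)\<^sup>2 / d\<^sup>2" using assms(4) by (simp add: le_divide_eq)
  qed
  also have "\<dots> \<le> (\<Sum>S\<in>Pow A. ?w S * (sum x S - ?m)\<^sup>2 / d\<^sup>2)"
    using w0 fin by (intro sum_mono2) auto
  also have "\<dots> = ?Z * ?V / d\<^sup>2"
    using tilted_second_moment[OF assms(2), of a x] a0 by (simp add: sum_divide_distrib[symmetric])
  finally have "?Z - ?Z * ?V / d\<^sup>2 \<le> ?Z - (\<Sum>S\<in>Pow A - I. ?w S)" by simp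
  also have "\<dots> = (\<Sum>S\<in>I. ?w S)"
    using sum.subset_diff[OF I fin(1), of ?w] sum_Pow_prod[OF assms(2), of a] by simp
  also have "\<dots> \<le> (\<Sum>S\<in>I. exp (- t * (?m - d)))"
  proof (rule sum_mono)
    fix S assume "S \<in> I"
    then have "S \<subseteq> A" "?m - d \<le> sum x S" by (auto simp: I_def abs_less_iff)
    then show "?w S \<le> exp (- t * (?m - d))" using assms(3) w by (simp add: mult_left_mono)
  qed
  also have "\<dots> = real (card I) * exp (- (t * (?m - d)))" by simp
  finally have "(?Z - ?Z * ?V / d\<^sup>2) * exp (t * (?m - d)) \<le> real (card I) * exp (- (t * (?m - d))) * exp (t * (?m - d))"
    by (rule mult_right_mono) simp
  also have "\<dots> = real (card I)" by (simp add: mult.assoc exp_add[symmetric])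
  finally show ?thesis unfolding I_def by (simp add: algebra_simps)
qed

text \<open>
  Each of the counted sets contributes the same weight \<open>exp (- t s)\<close> to the total weight.
\<close>

lemma card_subsets_with_sum_le:
  fixes x :: "'a \<Rightarrow> real" and t s :: real
  assumes "finite A"
  shows "real (card {S. S \<subseteq> A \<and> sum x S = s}) \<le> exp (t * s) * (\<Prod>n\<in>A. 1 + exp (- t * x n))"
proof -
  let ?I = "{S. S \<subseteq> A \<and> sum x S = s}"
  have w: "(\<Prod>n\<in>S. exp (- t * x n)) = exp (- t * sum x S)" if "S \<subseteq> A" for S
    using that assms by (simp add: exp_sum[symmetric] sum_distrib_left finite_subset sum_negf)
  have "real (card ?I) = (\<Sum>S\<in>?I. 1)" by simp
  also have "\<dots> = (\<Sum>S\<in>?I. exp (t * s) * (\<Prod>n\<in>S. exp (- t * x n)))"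
  proof (rule sum.cong[OF refl])
    fix S assume "S \<in> ?I"
    then have "(\<Prod>n\<in>S. exp (- t * x n)) = exp (- t * s)" using w by blast
    then show "1 = exp (t * s) * (\<Prod>n\<in>S. exp (- t * x n))" by (simp only:) (simp add: exp_add[symmetric])
  qed
  also have "\<dots> = exp (t * s) * (\<Sum>S\<in>?I. \<Prod>n\<in>S. exp (- t * x n))"
    by (rule sum_distrib_left[symmetric])
  also have "\<dots> \<le> exp (t * s) * (\<Sum>S\<in>Pow A. \<Prod>n\<in>S. exp (- t * x n))"
    using assms by (intro mult_left_mono sum_mono2) (auto intro: prod_nonneg)
  finally show ?thesis unfolding sum_Pow_prod[OF assms] .
qed

section \<open>Egyptian fractions with prescribed denominators\<close>

lemma dyadic_egyptian_fraction:
  assumes "s < 2 ^ Suc J"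
  shows "\<exists>T \<subseteq> (\<lambda>j. 2 ^ j) ` {..J}. (\<Sum>t\<in>T. 1 / real t) = real s / 2 ^ J"
  using assms
proof (induction J arbitrary: s)
  case 0
  then consider "s = 0" | "s = 1" by fastforce
  then show ?case
  proof cases
    case 1 then show ?thesis by (intro exI[of _ "{}"]) simp
  next
    case 2 then show ?thesis by (intro exI[of _ "{1}"]) simp
  qed
next
  case (Suc J)
  have "s div 2 < 2 ^ Suc J" using Suc.prems by simp
  then obtain T where T: "T \<subseteq> (\<lambda>j. 2 ^ j) ` {..J}" "(\<Sum>t\<in>T. 1 / real t) = real (s div 2) / 2 ^ J"
    using Suc.IH[of "s div 2"] by blast
  have fin: "finite T" using T(1) finite_subset by blast
  have "t \<le> 2 ^ J" if "t \<in> T" for t using that T(1) by auto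
  then have new: "2 ^ Suc J \<notin> T" by fastforce
  have half: "real s / 2 ^ Suc J = real (s div 2) / 2 ^ J + real (s mod 2) / 2 ^ Suc J"
  proof -
    have "real s = 2 * real (s div 2) + real (s mod 2)"
      using arg_cong[OF mult_div_mod_eq[of 2 s], of real] by (simp only: of_nat_add of_nat_mult of_nat_numeral)
    then show ?thesis by (simp add: add_divide_distrib)
  qed
  show ?case
  proof (cases "s mod 2 = 0")
    case True
    then show ?thesis using T half by (intro exI[of _ T]) (auto simp: atMost_Suc)
  next
    case False
    then have "s mod 2 = 1" by simp
    then show ?thesis using T half fin new
      by (intro exI[of _ "insert (2 ^ Suc J) T"]) (auto simp: atMost_Suc)
  qed
qed

lemma residue_in_window:
  fixes a b :: int and A q :: nat
  assumes "coprime a (int q)" "0 < q"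
  obtains s :: nat where "A \<le> s" "s < A + q" "int q dvd b - int s * a"
proof -
  obtain x where x: "[a * x = 1] (mod int q)"
    using cong_solve_coprime_int[OF assms(1)] by auto
  define s where "s = A + nat ((b * x - int A) mod int q)"
  have r: "0 \<le> (b * x - int A) mod int q" "(b * x - int A) mod int q < int q"
    using assms(2) by auto
  have "int s = int A + (b * x - int A) mod int q"
    using r by (simp add: s_def)
  then have "[int s = int A + (b * x - int A)] (mod int q)"
    by (simp add: cong_def mod_simps)
  then have "[int s * a = b * x * a] (mod int q)"
    by (intro cong_scalar_right) simp
  also have "[b * x * a = b * 1] (mod int q)"
    using cong_scalar_left[OF x, of b] by (simp add: mult_ac)
  finally have "int q dvd b - int s * a"
    by (simp add: cong_iff_dvd_diff dvd_diff_commute)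
  moreover have "A \<le> s" "s < A + q" using r by (auto simp: s_def nat_less_iff)
  ultimately show thesis using that by blast
qed

definition fraction_base :: "nat \<Rightarrow> nat set \<Rightarrow> nat set" where
  "fraction_base J F = (\<lambda>(q, j). q * 2 ^ j) ` (insert 1 F \<times> {..J})"

lemma sum_reciprocal_scale:
  assumes "0 < c"
  shows "(\<Sum>t\<in>(*) c ` T. 1 / real t) = (\<Sum>t\<in>T. 1 / real t) / real c"
proof -
  have "inj_on ((*) c) T" using assms by (intro inj_onI) simp
  then show ?thesis
    by (subst sum.reindex) (simp_all add: sum_divide_distrib mult.commute)
qed

text \<open>
  In the induction step the residue of \<open>n\<close> modulo the new modulus \<open>q\<close> is removed by subtracting
  \<open>s / (2^J q)\<close> with \<open>s < q\<close>, a sum of unit fractions \<open>1 / (2^j q)\<close> by binary expansion of \<open>s\<close>. Each such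
  subtraction costs less than the product of all moduli in the numerator, hence the lower bound on
  \<open>n\<close>. The denominators used at different steps are distinct, as those of the earlier moduli are coprime to \<open>q\<close>.
\<close>

lemma egyptian_fraction_in_base:
  assumes "finite F" and "\<And>q. q \<in> F \<Longrightarrow> odd q \<and> 1 < q \<and> q \<le> 2 ^ J"
    and "pairwise coprime F"
    and "card F * \<Prod>F \<le> n" "n \<le> 2 ^ J * \<Prod>F"
  shows "\<exists>T \<subseteq> fraction_base J F. (\<Sum>t\<in>T. 1 / real t) = real n / real (2 ^ J * \<Prod>F)"
  using assms
proof (induction F arbitrary: n rule: finite_induct)
  case empty
  then have "n < 2 ^ Suc J" by (auto intro: le_less_trans)
  moreover have "fraction_base J {} = (\<lambda>j. 2 ^ j) ` {..J}"
    by (force simp: fraction_base_def)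
  ultimately show ?case using dyadic_egyptian_fraction[of n J] by simp
next
  case (insert q F)
  have q: "odd q" "1 < q" "q \<le> 2 ^ J" using insert.prems(1)[of q] by auto
  have cop: "coprime q' q" if "q' \<in> F" for q'
    using insert.prems(2) insert.hyps that by (auto simp: pairwise_insert coprime_commute)
  then have "coprime (\<Prod>F) q" by (intro prod_coprime_left) auto
  then have "coprime (int (\<Prod>F)) (int q)" by (simp only: coprime_int_iff)
  then obtain s where s: "s < q" "int q dvd int n - int s * int (\<Prod>F)"
    using residue_in_window[of "int (\<Prod>F)" q 0 "int n"] q by auto
  have prodq: "\<Prod>(insert q F) = q * \<Prod>F" using insert.hyps by simp
  have "s * \<Prod>F \<le> q * \<Prod>F" using s by (intro mult_right_mono) auto
  moreover have lo: "card F * (q * \<Prod>F) + q * \<Prod>F \<le> n"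
    using insert.prems(3) insert.hyps by (simp add: algebra_simps)
  ultimately have le: "s * \<Prod>F \<le> n" by linarith
  then have "q dvd n - s * \<Prod>F"
    using s(2) by (metis of_nat_diff of_nat_dvd_iff of_nat_mult)
  then obtain n' where n': "n - s * \<Prod>F = q * n'" by (auto elim: dvdE)
  then have n: "n = q * n' + s * \<Prod>F" using le by linarith
  have "card F * (q * \<Prod>F) \<le> q * n'"
    using lo \<open>s * \<Prod>F \<le> q * \<Prod>F\<close> n by linarith
  then have "q * (card F * \<Prod>F) \<le> q * n'" by (simp only: mult.left_commute)
  then have lo': "card F * \<Prod>F \<le> n'" using q by simp
  have "q * n' \<le> 2 ^ J * (q * \<Prod>F)"
    using n insert.prems(4) unfolding prodq by linarith
  then have "q * n' \<le> q * (2 ^ J * \<Prod>F)" by (simp only: mult.left_commute)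
  then have hi': "n' \<le> 2 ^ J * \<Prod>F" using q by simp
  obtain T where T: "T \<subseteq> fraction_base J F" "(\<Sum>t\<in>T. 1 / real t) = real n' / real (2 ^ J * \<Prod>F)"
    using insert.IH[of n'] insert.prems lo' hi' by (auto simp: pairwise_insert)
  have "s < 2 ^ Suc J" using s q by simp
  then obtain U where U: "U \<subseteq> (\<lambda>j. 2 ^ j) ` {..J}" "(\<Sum>t\<in>U. 1 / real t) = real s / 2 ^ J"
    using dyadic_egyptian_fraction by blast
  have fin: "finite T" "finite U"
    using finite_subset[OF T(1)] finite_subset[OF U(1)] insert.hyps by (auto simp: fraction_base_def)
  have "\<not> q dvd t" if "t \<in> T" for t
  proof -
    have "coprime t q" using that T(1) q cop by (auto simp: fraction_base_def)
    then show ?thesis using q by (auto simp: coprime_absorb_right)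
  qed
  then have disj: "T \<inter> (*) q ` U = {}" by fastforce
  have "(*) q ` U \<subseteq> fraction_base J (insert q F)"
    using U(1) by (force simp: fraction_base_def)
  moreover have "T \<subseteq> fraction_base J (insert q F)"
    using T(1) by (force simp: fraction_base_def)
  moreover have "(\<Sum>t\<in>T \<union> (*) q ` U. 1 / real t) = real n / real (2 ^ J * \<Prod>(insert q F))"
  proof -
    have "\<forall>q\<in>F. 0 < q" using insert.prems(1) by (metis insertCI not_less_zero gr0I)
    then have pos: "\<Prod>F > 0" by (intro prod_pos) auto
    have "(\<Sum>t\<in>T \<union> (*) q ` U. 1 / real t) = real n' / real (2 ^ J * \<Prod>F) + real s / 2 ^ J / real q"
      using sum.union_disjoint[OF fin(1) finite_imageI[OF fin(2)] disj, of "\<lambda>t. 1 / real t"]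
        T(2) U(2) sum_reciprocal_scale[of q U] q by simp
    also have "\<dots> = real n / real (2 ^ J * \<Prod>(insert q F))"
      unfolding prodq n using pos q by (simp add: field_simps del: of_nat_prod)
    finally show ?thesis .
  qed
  ultimately show ?case by (intro exI[of _ "T \<union> (*) q ` U"]) auto
qed

text \<open>
  The fractions \<open>n / M\<close> with \<open>A \<le> n \<le> M\<close> are assumed to be representable by denominators from \<open>\<Delta>\<close>. A
  window of \<open>p\<close> consecutive values of \<open>n\<close> meets every residue class modulo \<open>p\<close>, so some \<open>n / (M p)\<close> with
  \<open>A \<le> n < A + p\<close> removes \<open>p\<close> from the denominator of \<open>r\<close>; it is represented by \<open>p \<Delta>\<close>. The last
  hypothesis says that after all these subtractions enough is left to represent the remainder over \<open>M\<close>.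
\<close>

lemma egyptian_fraction_clearing_primes:
  fixes M A :: nat and \<Delta> P :: "nat set" and b :: int
  assumes "finite P" and rep: "\<And>n. A \<le> n \<Longrightarrow> n \<le> M \<Longrightarrow> \<exists>T\<subseteq>\<Delta>. (\<Sum>t\<in>T. 1 / real t) = real n / real M"
    and "0 < M" "finite \<Delta>" and dvd: "\<And>m. m \<in> \<Delta> \<Longrightarrow> m dvd M"
    and "\<And>p. p \<in> P \<Longrightarrow> prime p \<and> \<not> p dvd M \<and> A + p \<le> M"
    and "r = real_of_int b / real (M * \<Prod>P)" "r \<le> 1"
    and "real A / real M + (\<Sum>p\<in>P. real (A + p) / (real M * real p)) \<le> r"
  shows "\<exists>T \<subseteq> \<Delta> \<union> (\<Union>p\<in>P. (*) p ` \<Delta>). (\<Sum>t\<in>T. 1 / real t) = r"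
  using assms(1,6-)
proof (induction P arbitrary: r b rule: finite_induct)
  case empty
  then have "real_of_int (int A) \<le> real_of_int b" "real_of_int b \<le> real_of_int (int M)"
    using \<open>0 < M\<close> by (auto simp: divide_le_cancel divide_le_eq)
  then have "int A \<le> b" "b \<le> int M" by linarith+
  then show ?case using rep[of "nat b"] empty.prems by (auto simp: nat_le_iff)
next
  case (insert p P)
  have p: "prime p" "\<not> p dvd M" "A + p \<le> M" "p > 0" using insert.prems(1)[of p] prime_gt_0_nat by auto
  have cop: "coprime p' p" if "p' \<in> P" for p'
    using insert.prems(1) insert.hyps that p primes_coprime by blast
  then have "coprime (\<Prod>P) p" by (intro prod_coprime_left) auto
  then have "coprime (int (\<Prod>P)) (int p)" by (simp only: coprime_int_iff)
  then obtain n where n: "A \<le> n" "n < A + p" "int p dvd b - int n * int (\<Prod>P)"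
    using residue_in_window[of "int (\<Prod>P)" p A b] p by auto
  then obtain b' where b': "b - int n * int (\<Prod>P) = int p * b'" by (auto elim: dvdE)
  have prodp: "\<Prod>(insert p P) = p * \<Prod>P" using insert.hyps by simp
  have "\<forall>p\<in>P. 0 < p" using insert.prems(1) prime_gt_0_nat by blast
  then have pos: "\<Prod>P > 0" by (intro prod_pos) auto
  define r' where "r' = r - real n / (real M * real p)"
  have "real_of_int b = real n * real (\<Prod>P) + real p * real_of_int b'"
    using arg_cong[OF b', of real_of_int] by simp
  then have r': "r' = real_of_int b' / real (M * \<Prod>P)"
    unfolding r'_def insert.prems(2) prodp using pos p \<open>0 < M\<close>
    by (simp add: field_simps del: of_nat_prod)
  have "real n / (real M * real p) \<le> real (A + p) / (real M * real p)"
    using n by (intro divide_right_mono) auto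
  then have "real A / real M + (\<Sum>p\<in>P. real (A + p) / (real M * real p)) \<le> r'"
    using insert.prems(4) insert.hyps unfolding r'_def by simp
  moreover have "r' \<le> 1"
    using insert.prems(3) unfolding r'_def by (smt (verit) divide_nonneg_nonneg mult_nonneg_nonneg of_nat_0_le_iff)
  ultimately obtain T where T: "T \<subseteq> \<Delta> \<union> (\<Union>p\<in>P. (*) p ` \<Delta>)" "(\<Sum>t\<in>T. 1 / real t) = r'"
    using insert.IH[of r' b'] insert.prems(1) r' by auto
  have "n \<le> M" using n p by linarith
  then obtain U where U: "U \<subseteq> \<Delta>" "(\<Sum>t\<in>U. 1 / real t) = real n / real M" using rep n(1) by blast
  have fin: "finite T" "finite U"
    using finite_subset[OF T(1)] finite_subset[OF U(1)] insert.hyps \<open>finite \<Delta>\<close> by auto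
  have "\<not> p dvd t" if "t \<in> T" for t
  proof
    assume "p dvd t"
    have "t \<in> \<Delta> \<or> (\<exists>p'\<in>P. \<exists>m\<in>\<Delta>. t = p' * m)" using that T(1) by blast
    then consider "t \<in> \<Delta>" | p' m where "p' \<in> P" "m \<in> \<Delta>" "t = p' * m" by blast
    then show False
    proof cases
      case 1
      then show False using dvd p(2) \<open>p dvd t\<close> dvd_trans by blast
    next
      case 2
      then have "p dvd m" using \<open>p dvd t\<close> cop[of p'] by (metis coprime_commute coprime_dvd_mult_right_iff)
      then show False using dvd[OF 2(2)] p(2) dvd_trans by blast
    qed
  qed
  then have disj: "T \<inter> (*) p ` U = {}" by fastforce
  have "(\<Sum>t\<in>T \<union> (*) p ` U. 1 / real t) = r' + real n / real M / real p"
    using sum.union_disjoint[OF fin(1) finite_imageI[OF fin(2)] disj, of "\<lambda>t. 1 / real t"]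
      T(2) U(2) sum_reciprocal_scale[of p U] p by simp
  also have "\<dots> = r" by (simp add: r'_def)
  finally show ?case using T(1) U(1) by (intro exI[of _ "T \<union> (*) p ` U"]) auto
qed

section \<open>Integers with large prime factors are rare\<close>

lemma prod_distinct_primes_dvd:
  fixes n :: nat
  assumes "finite P" "\<And>p. p \<in> P \<Longrightarrow> prime p \<and> p dvd n"
  shows "\<Prod>P dvd n"
  using assms
proof (induction P rule: finite_induct)
  case (insert p P)
  have "coprime p q" if "q \<in> P" for q
    using insert that by (metis insertCI primes_coprime)
  then have "coprime p (\<Prod>P)" by (intro prod_coprime_right) auto
  then show ?case using insert by (simp add: divides_mult)
qed simp

text \<open>
  The primes in \<open>(n, 2n]\<close> all divide the central binomial coefficient, which is at most \<open>4^n\<close>.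
\<close>

lemma card_primes_dyadic:
  "card {p. prime p \<and> 2 ^ i < p \<and> p \<le> (2::nat) ^ Suc i} * i \<le> 2 ^ Suc i"
proof -
  define n :: nat where "n = 2 ^ i"
  define P where "P = {p. prime p \<and> n < p \<and> p \<le> 2 * n}"
  have fin: "finite P" by (rule finite_subset[of _ "{..2 * n}"]) (auto simp: P_def)
  have "p dvd (2 * n choose n)" if "p \<in> P" for p
  proof -
    have p: "prime p" "n < p" "p \<le> 2 * n" using that by (auto simp: P_def)
    have "p dvd fact n * fact (2 * n - n) * (2 * n choose n)"
      using binomial_fact_lemma[of n "2 * n"] p by (simp add: prime_dvd_fact_iff)
    then show ?thesis using p by (simp add: prime_dvd_mult_iff prime_dvd_fact_iff)
  qed
  then have "\<Prod>P dvd (2 * n choose n)"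
    by (intro prod_distinct_primes_dvd fin) (auto simp: P_def)
  then have "\<Prod>P \<le> (2 * n choose n)" by (rule dvd_imp_le) simp
  also have "\<dots> \<le> 2 ^ (2 * n)" by (rule binomial_le_pow2)
  finally have "\<Prod>P \<le> 2 ^ (2 * n)" .
  moreover have "n ^ card P \<le> \<Prod>P"
    using prod_mono[of P "\<lambda>_. n" "\<lambda>p. p"] by (auto simp: P_def)
  ultimately have "n ^ card P \<le> 2 ^ (2 * n)" by linarith
  then have "(2::nat) ^ (i * card P) \<le> 2 ^ (2 * n)" by (simp add: n_def power_mult)
  then have "i * card P \<le> 2 * n" by (simp only: power_increasing_iff)
  then show ?thesis by (simp add: P_def n_def mult.commute)
qed

lemma sum_reciprocal_primes_dyadic_le:
  assumes "1 \<le> a" "a \<le> b"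
  shows "(\<Sum>p | prime p \<and> 2 ^ a < p \<and> p \<le> (2::nat) ^ b. 1 / real p) \<le> 2 * real (b - a) / real a"
  using assms(2)
proof (induction b rule: dec_induct)
  case base
  have "{p::nat. prime p \<and> 2 ^ a < p \<and> p \<le> 2 ^ a} = {}" by auto
  then show ?case by (simp only: sum.empty) simp
next
  case (step b)
  let ?Q = "\<lambda>a b. {p. prime p \<and> 2 ^ a < p \<and> p \<le> (2::nat) ^ b}"
  have fin: "finite (?Q a b)" for a b by (rule finite_subset[of _ "{..2 ^ b}"]) auto
  have "(2::nat) ^ a \<le> 2 ^ b" using step.hyps by (intro power_increasing) auto
  then have "2 ^ a < p" if "2 ^ b < p" for p :: nat using that by (rule le_less_trans)
  then have split: "?Q a (Suc b) = ?Q a b \<union> ?Q b (Suc b)" by auto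
  have "?Q a b \<inter> ?Q b (Suc b) = {}" by auto
  then have "(\<Sum>p\<in>?Q a (Suc b). 1 / real p) = (\<Sum>p\<in>?Q a b. 1 / real p) + (\<Sum>p\<in>?Q b (Suc b). 1 / real p)"
    unfolding split using fin by (intro sum.union_disjoint) auto
  also have "(\<Sum>p\<in>?Q b (Suc b). 1 / real p) \<le> (\<Sum>p\<in>?Q b (Suc b). 1 / 2 ^ b)"
  proof (rule sum_mono)
    fix p assume "p \<in> ?Q b (Suc b)"
    then have "real (2 ^ b) \<le> real p" by (auto simp only: of_nat_le_iff mem_Collect_eq)
    then show "1 / real p \<le> 1 / 2 ^ b" by (simp add: frac_le)
  qed
  also have "\<dots> = real (card (?Q b (Suc b))) / 2 ^ b" by simp
  also have "\<dots> \<le> 2 / real b"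
  proof -
    have "real (card (?Q b (Suc b)) * b) \<le> real (2 ^ Suc b)"
      using card_primes_dyadic[of b] by (simp only: of_nat_le_iff)
    then have "real (card (?Q b (Suc b))) * real b \<le> 2 * 2 ^ b" by simp
    moreover have "0 < real b" using step.hyps assms by simp
    ultimately show ?thesis by (simp only: divide_le_eq le_divide_eq times_divide_eq_left zero_less_power zero_less_numeral if_True)
  qed
  also have "2 / real b \<le> 2 / real a" using step.hyps assms by (simp add: frac_le)
  also have "(\<Sum>p\<in>?Q a b. 1 / real p) \<le> 2 * real (b - a) / real a" by (rule step.IH)
  finally have "(\<Sum>p\<in>?Q a (Suc b). 1 / real p) \<le> 2 * real (b - a) / real a + 2 / real a" by simp
  also have "\<dots> = 2 * real (Suc b - a) / real a"
    using step.hyps by (simp add: Suc_diff_le add_divide_distrib[symmetric])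
  finally show ?case .
qed

lemma card_multiples_le:
  fixes A :: "nat set"
  assumes "finite A" "0 \<notin> A"
  shows "real (card {n \<in> {1..N}. \<exists>d\<in>A. d dvd n}) \<le> real N * (\<Sum>d\<in>A. 1 / real d)"
proof -
  have one: "real (card {n \<in> {1..N}. d dvd n}) \<le> real N / real d" if "0 < d" for d
  proof -
    have "{n \<in> {1..N}. d dvd n} \<subseteq> (*) d ` {1..N div d}"
    proof
      fix n assume n: "n \<in> {n \<in> {1..N}. d dvd n}"
      then have "n = d * (n div d)" "1 \<le> n div d" "n div d \<le> N div d"
        using that by (auto simp: div_greater_zero_iff Suc_le_eq dvd_imp_le div_le_mono)
      then show "n \<in> (*) d ` {1..N div d}" by (metis atLeastAtMost_iff imageI)
    qed
    then have "card {n \<in> {1..N}. d dvd n} \<le> card ((*) d ` {1..N div d})" by (intro card_mono) auto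
    also have "\<dots> \<le> N div d" using card_image_le[of "{1..N div d}" "(*) d"] by simp
    finally have "card {n \<in> {1..N}. d dvd n} \<le> N div d" .
    then have "real (card {n \<in> {1..N}. d dvd n}) \<le> real (N div d)" by simp
    also have "\<dots> \<le> real N / real d" by (rule of_nat_div_le_of_nat)
    finally show ?thesis .
  qed
  have "{n \<in> {1..N}. \<exists>d\<in>A. d dvd n} = (\<Union>d\<in>A. {n \<in> {1..N}. d dvd n})" by auto
  then have "card {n \<in> {1..N}. \<exists>d\<in>A. d dvd n} \<le> (\<Sum>d\<in>A. card {n \<in> {1..N}. d dvd n})"
    using card_UN_le[OF assms(1), of "\<lambda>d. {n \<in> {1..N}. d dvd n}"] by simp
  then have "real (card {n \<in> {1..N}. \<exists>d\<in>A. d dvd n}) \<le> (\<Sum>d\<in>A. real (card {n \<in> {1..N}. d dvd n}))"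
    unfolding of_nat_sum[symmetric] by (rule of_nat_mono)
  also have "\<dots> \<le> (\<Sum>d\<in>A. real N * (1 / real d))"
  proof (rule sum_mono)
    fix d assume "d \<in> A"
    then have "0 < d" using assms(2) by (cases "d = 0") auto
    then show "real (card {n \<in> {1..N}. d dvd n}) \<le> real N * (1 / real d)" using one by simp
  qed
  finally show ?thesis unfolding sum_distrib_left .
qed

lemma sum_reciprocal_squares_le:
  assumes "1 \<le> z" "z \<le> N"
  shows "(\<Sum>d\<in>{z<..N}. 1 / (real d)\<^sup>2) \<le> 1 / real z - 1 / real N"
  using assms(2)
proof (induction N rule: dec_induct)
  case (step N)
  have "{z<..Suc N} = insert (Suc N) {z<..N}" using step.hyps by auto
  moreover have "1 / (real (Suc N))\<^sup>2 \<le> 1 / real N - 1 / real (Suc N)"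
  proof -
    have "0 < N" using step.hyps assms(1) by linarith
    then have "1 / (real (Suc N))\<^sup>2 \<le> 1 / (real N * real (Suc N))"
      by (intro divide_left_mono) (auto simp: power2_eq_square)
    also have "\<dots> = 1 / real N - 1 / real (Suc N)" using \<open>0 < N\<close> by (simp add: field_simps)
    finally show ?thesis .
  qed
  ultimately show ?case using step.IH by simp
qed simp

lemma dvd_by_prime_powers:
  fixes n m :: nat
  assumes "n \<noteq> 0" "m \<noteq> 0" "\<And>p k. prime p \<Longrightarrow> 0 < k \<Longrightarrow> p ^ k dvd n \<Longrightarrow> p ^ k dvd m"
  shows "n dvd m"
proof (rule multiplicity_le_imp_dvd[OF assms(1)])
  fix p :: nat assume p: "prime p"
  show "multiplicity p n \<le> multiplicity p m"
  proof (cases "multiplicity p n = 0")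
    case False
    then have "p ^ multiplicity p n dvd m" by (intro assms p) (auto simp: multiplicity_dvd)
    then show ?thesis using p assms(2) by (intro multiplicity_geI) auto
  qed simp
qed

text \<open>
  Up to \<open>N\<close>, each of the four excluded kinds of divisors occurs rarely: for squares of integers above
  \<open>z\<close> and for primes above \<open>X\<close> the sum of reciprocals is small, and the finitely many prime powers are
  chosen large. So almost all integers divide this modulus.
\<close>

lemma dvd_modulus_if_no_large_factors:
  fixes n z X J :: nat and e :: "nat \<Rightarrow> nat"
  defines "R \<equiv> {p. prime p \<and> odd p \<and> p \<le> z}" and "P \<equiv> {p. prime p \<and> z < p \<and> p \<le> X}"
  assumes "0 < n" "2 \<le> z" "\<not> 2 ^ Suc J dvd n" "\<And>r. r \<in> R \<Longrightarrow> \<not> r ^ Suc (e r) dvd n"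
    and "\<And>d. z < d \<Longrightarrow> \<not> d\<^sup>2 dvd n" "\<And>p. prime p \<Longrightarrow> X < p \<Longrightarrow> \<not> p dvd n"
  shows "n dvd 2 ^ J * (\<Prod>r\<in>R. r ^ e r) * \<Prod>P"
proof (rule dvd_by_prime_powers)
  have fin: "finite R" "finite P"
    by (auto simp: R_def P_def intro: finite_subset[of _ "{..z}"] finite_subset[of _ "{..X}"])
  have "\<forall>r\<in>R. 0 < r ^ e r" "\<forall>p\<in>P. 0 < p" by (auto simp: R_def P_def prime_gt_0_nat)
  then have "0 < (\<Prod>r\<in>R. r ^ e r)" "0 < \<Prod>P" by (auto intro!: prod_pos)
  then show "2 ^ J * (\<Prod>r\<in>R. r ^ e r) * \<Prod>P \<noteq> 0" by simp
  fix p k :: nat assume p: "prime p" "0 < k" "p ^ k dvd n"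
  have le: "k \<le> j" if "\<not> p ^ Suc j dvd n" for j
    using that p(3) by (meson le_imp_power_dvd dvd_trans not_less_eq_eq)
  consider "p = 2" | "p \<in> R" | "z < p" using p(1) prime_odd_nat[of p] prime_ge_2_nat[of p]
    by (fastforce simp: R_def)
  then show "p ^ k dvd 2 ^ J * (\<Prod>r\<in>R. r ^ e r) * \<Prod>P"
  proof cases
    case 1
    then have "p ^ k dvd 2 ^ J" using le[of J] assms by (simp add: le_imp_power_dvd)
    then show ?thesis by (metis dvd_mult2)
  next
    case 2
    then have "p ^ k dvd p ^ e p" using le[of "e p"] assms by (simp add: le_imp_power_dvd)
    also have "p ^ e p dvd (\<Prod>r\<in>R. r ^ e r)" using 2 fin by (intro dvd_prodI)
    finally show ?thesis by (metis dvd_mult dvd_mult2)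
  next
    case 3
    then have "k = 1" using le[of 1] assms(7)[of p] p(2) by (simp add: power2_eq_square)
    moreover have "p \<in> P"
      using 3 p \<open>k = 1\<close> assms(8)[of p] by (cases "X < p") (auto simp: P_def)
    ultimately have "p ^ k dvd \<Prod>P" using dvd_prodI[OF fin(2), of p "\<lambda>p. p"] by simp
    then show ?thesis by (rule dvd_mult)
  qed
qed (use assms in auto)

section \<open>Sets whose subsets complete to reciprocal sum one\<close>

lemma fraction_base_properties:
  assumes "finite F" "\<And>q. q \<in> F \<Longrightarrow> 0 < q \<and> q \<le> 2 ^ J" and m: "m \<in> fraction_base J F"
  shows "m dvd 2 ^ J * \<Prod>F" "1 \<le> m" "m \<le> 4 ^ J"
proof -
  obtain q j where qj: "q \<in> insert 1 F" "j \<le> J" "m = q * 2 ^ j"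
    using m by (auto simp: fraction_base_def)
  have q: "q dvd \<Prod>F" "0 < q" "q \<le> 2 ^ J"
    using qj(1) assms(1,2) dvd_prodI[OF assms(1), of q "\<lambda>q. q"] by auto
  have "(2::nat) ^ j dvd 2 ^ J" "(2::nat) ^ j \<le> 2 ^ J"
    using qj(2) by (simp_all add: le_imp_power_dvd)
  moreover have "(2::nat) ^ J * 2 ^ J = 4 ^ J" by (simp flip: power_mult_distrib)
  ultimately show "m dvd 2 ^ J * \<Prod>F" "m \<le> 4 ^ J" "1 \<le> m"
    using q qj(3) mult_dvd_mono[of "2 ^ j" "2 ^ J" q "\<Prod>F"] mult_le_mono[of q "2 ^ J" "2 ^ j" "2 ^ J"]
    by (simp_all add: mult.commute[of q] Suc_le_eq)
qed

lemma card_fraction_base_le: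
  assumes "finite F" shows "finite (fraction_base J F)" "card (fraction_base J F) \<le> Suc (card F) * Suc J"
proof -
  show "finite (fraction_base J F)" using assms by (auto simp: fraction_base_def)
  have "card (fraction_base J F) \<le> card (insert 1 F \<times> {..J})"
    unfolding fraction_base_def using assms by (intro card_image_le) auto
  also have "\<dots> = card (insert 1 F) * Suc J" by (simp add: card_cartesian_product)
  also have "\<dots> \<le> Suc (card F) * Suc J"
    using card_insert_le_m1[of "Suc (card F)" F 1] by (intro mult_right_mono) auto
  finally show "card (fraction_base J F) \<le> Suc (card F) * Suc J" .
qed

text \<open>
  The construction with explicit parameters. The constants \<open>z\<close> and \<open>K\<close> control the density of the
  discarded integers, while \<open>J\<close> grows with \<open>N\<close>, so that all terms with \<open>2^J\<close> in the denominator
  become negligible; the bound on \<open>\<Prod>R\<close> makes \<open>Y\<close> at least as large as every prime to be cleared.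
\<close>

lemma completable_set_explicit:
  fixes z K I J N :: nat
  defines "R \<equiv> {p. prime p \<and> odd p \<and> p \<le> z}" and "k \<equiv> card {p. prime p \<and> odd p \<and> p \<le> z}"
  assumes "2 \<le> z" "3 \<le> K" "K \<le> k" "J = I div K" "1 \<le> J" "2 ^ I \<le> N" "N < 2 ^ Suc I"
    and "z \<le> 2 ^ J" "Suc k \<le> 2 ^ J" "\<Prod>R * 2 ^ K \<le> 4 ^ J"
  shows "\<exists>B \<subseteq> {1..N}.
    real (card ({1..N} - B)) \<le> real N * (3 * real (Suc k) / 2 ^ J + 1 / real z + 6 / real (K - 2)) \<and>
    (\<forall>S \<subseteq> B. (\<Sum>s\<in>S. 1 / real s) \<le> 1 - real (Suc k) * real (1 + 2 * I) / 2 ^ J \<longrightarrow>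
      (\<exists>T \<subseteq> {1..N} - B. (\<Sum>s\<in>S. 1 / real s) + (\<Sum>t\<in>T. 1 / real t) = 1))"
proof -
  have finR: "finite R" by (auto simp: R_def intro: finite_subset[of _ "{..z}"])
  have R: "prime r" "odd r" "3 \<le> r" "r \<le> 2 ^ J" if "r \<in> R" for r
  proof -
    show "prime r" "odd r" "r \<le> 2 ^ J" using that assms(10) by (auto simp: R_def)
    then show "3 \<le> r" using prime_ge_2_nat[of r] by (cases "r = 2") auto
  qed
  define e where "e r = (SOME n. r ^ n \<le> 2 ^ J \<and> 2 ^ J < r ^ Suc n)" for r :: nat
  have e: "r ^ e r \<le> 2 ^ J" "2 ^ J < r ^ Suc (e r)" if "r \<in> R" for r
  proof -
    have "\<exists>n. r ^ n \<le> 2 ^ J \<and> 2 ^ J < r ^ (n + 1)" using R[OF that] by (intro ex_power_ivl1) auto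
    then have "r ^ e r \<le> 2 ^ J \<and> 2 ^ J < r ^ Suc (e r)" unfolding e_def Suc_eq_plus1 by (rule someI_ex)
    then show "r ^ e r \<le> 2 ^ J" "2 ^ J < r ^ Suc (e r)" by auto
  qed
  have epos: "0 < e r" if "r \<in> R" for r using e[OF that] R[OF that] by (cases "e r") auto
  define F where "F = (\<lambda>r. r ^ e r) ` R"
  have cop: "coprime (r ^ e r) (r' ^ e r')" if "r \<in> R" "r' \<in> R" "r \<noteq> r'" for r r'
    using that R primes_coprime[of r r'] by (simp add: coprime_power_left_iff coprime_power_right_iff)
  have gt1: "1 < r ^ e r" if "r \<in> R" for r
    using R[OF that] epos[OF that] by (intro one_less_power) auto
  have inj: "inj_on (\<lambda>r. r ^ e r) R"
  proof (rule inj_onI, rule ccontr)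
    fix r r' assume "r \<in> R" "r' \<in> R" "r ^ e r = r' ^ e r'" "r \<noteq> r'"
    then have "coprime (r' ^ e r') (r' ^ e r')" using cop[of r r'] by metis
    then have "r' ^ e r' = 1" unfolding coprime_self by (simp only: nat_dvd_1_iff_1)
    then show False using gt1[OF \<open>r' \<in> R\<close>] by (metis less_irrefl)
  qed
  have F: "finite F" "\<And>q. q \<in> F \<Longrightarrow> odd q \<and> 1 < q \<and> q \<le> 2 ^ J" "pairwise coprime F" "card F = k"
  proof -
    show "finite F" using finR by (simp add: F_def)
    show "odd q \<and> 1 < q \<and> q \<le> 2 ^ J" if "q \<in> F" for q
      using that R e gt1 by (auto simp: F_def)
    show "pairwise coprime F" unfolding F_def by (intro pairwise_imageI cop)
    show "card F = k" using inj by (simp add: F_def card_image k_def R_def)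
  qed
  define Y where "Y = \<Prod>F"
  have Y: "Y = (\<Prod>r\<in>R. r ^ e r)" using inj by (simp add: Y_def F_def prod.reindex)
  define M where "M = 2 ^ J * Y"
  have "\<forall>q\<in>F. 0 < q" using F(2) by fastforce
  then have Ypos: "0 < Y" unfolding Y_def by (intro prod_pos) auto
  then have Mpos: "0 < M" by (simp add: M_def)

  \<comment> \<open>The cut-off \<open>2 ^ a\<close> for primes is a power of two, so that the dyadic estimates apply to it exactly.\<close>
  define a where "a = I - 2 * J"
  have KJ: "K * J \<le> I" "I < K * J + K"
    using times_div_less_eq_dividend[of K I] dividend_less_times_div[of K I] assms(4) unfolding assms(6)
    by linarith+
  have "3 * J \<le> K * J" using assms(4) by (intro mult_right_mono) auto
  then have "3 * J \<le> I" using KJ by linarith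
  then have I: "I = a + 2 * J" and a: "1 \<le> a" using assms(7) by (simp_all add: a_def)
  define X where "X = (2::nat) ^ a"
  have X4: "X * 4 ^ J \<le> N" using assms(8) by (simp add: X_def I power_add power_mult)
  have Xpos: "0 < X" by (simp add: X_def)
  have XY: "X \<le> Y"
  proof -
    have "X * (\<Prod>R * 2 ^ K) \<le> X * 4 ^ J" using assms(12) by (intro mult_left_mono) auto
    also have "\<dots> = 2 ^ I" by (simp add: X_def I power_add power_mult)
    also have "\<dots> \<le> 2 ^ (K * J + K)" using KJ by (intro power_increasing) auto
    also have "\<dots> = (2 ^ J) ^ K * 2 ^ K" by (simp add: power_add mult.commute[of K] flip: power_mult)
    also have "((2::nat) ^ J) ^ K \<le> (2 ^ J) ^ k" using assms(5) by (intro power_increasing) auto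
    also have "((2::nat) ^ J) ^ k = (\<Prod>r\<in>R. 2 ^ J)" by (simp add: k_def R_def)
    also have "\<dots> \<le> (\<Prod>r\<in>R. r ^ Suc (e r))" using e by (intro prod_mono) (auto intro: less_imp_le)
    also have "\<dots> = \<Prod>R * Y" by (simp add: Y prod.distrib)
    finally have "(\<Prod>R * 2 ^ K) * X \<le> (\<Prod>R * 2 ^ K) * Y" by (simp add: mult_ac)
    moreover have "0 < \<Prod>R" using R by (intro prod_pos) (auto intro: prime_gt_0_nat)
    ultimately show ?thesis by simp
  qed

  define P where "P = {p. prime p \<and> z < p \<and> p \<le> X}"
  have finP: "finite P" by (auto simp: P_def intro: finite_subset[of _ "{..X}"])
  have P: "prime p" "z < p" "p \<le> X" "0 < p" if "p \<in> P" for p using that by (auto simp: P_def prime_gt_0_nat)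
  have PM: "\<not> p dvd M" if "p \<in> P" for p
  proof
    assume "p dvd M"
    then have "p dvd 2 ^ J \<or> (\<exists>r\<in>R. p dvd r ^ e r)"
      using P(1)[OF that] finR unfolding M_def Y by (simp add: prime_dvd_mult_iff prime_dvd_prod_iff)
    then have "p dvd 2 \<or> (\<exists>r\<in>R. p dvd r)"
      using prime_dvd_power[OF P(1)[OF that]] by blast
    moreover have "0 < r" "r \<le> z" if "r \<in> R" for r using that by (auto simp: R_def prime_gt_0_nat)
    ultimately have "p \<le> z" using assms(3) dvd_imp_le[of p] by (meson order.trans pos2)
    then show False using P[OF that] by simp
  qed
  have "\<forall>p\<in>P. 0 < p" using P by auto
  then have Ppos: "0 < \<Prod>P" by (intro prod_pos) auto

  define \<Delta> where "\<Delta> = fraction_base J F"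
  have "\<And>q. q \<in> F \<Longrightarrow> 0 < q \<and> q \<le> 2 ^ J" using F(2) by fastforce
  then have \<Delta>: "m dvd M" "1 \<le> m" "m \<le> 4 ^ J" if "m \<in> \<Delta>" for m
    using fraction_base_properties[OF F(1), of J m] that by (auto simp: M_def Y_def \<Delta>_def)
  have card\<Delta>: "finite \<Delta>" "card \<Delta> \<le> Suc k * Suc J"
    using card_fraction_base_le[OF F(1), of J] F(4) by (auto simp: \<Delta>_def)
  have rep: "\<exists>T\<subseteq>\<Delta>. (\<Sum>t\<in>T. 1 / real t) = real n / real M" if "k * Y \<le> n" "n \<le> M" for n
    using egyptian_fraction_in_base[OF F(1,2,3), of n] that by (simp add: F(4) \<Delta>_def M_def Y_def)
  have room: "k * Y + p \<le> M" if "p \<in> P" for p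
  proof -
    have "k * Y + p \<le> Suc k * Y" using P[OF that] XY by simp
    also have "\<dots> \<le> M" unfolding M_def using assms(11) by (intro mult_right_mono) auto
    finally show ?thesis .
  qed

  have Pcond: "prime p \<and> \<not> p dvd M \<and> k * Y + p \<le> M" if "p \<in> P" for p
    using P(1) PM room that by blast

  \<comment> \<open>The reserved denominators, from which every completion is drawn.\<close>
  define D where "D = \<Delta> \<union> (\<Union>p\<in>P. (*) p ` \<Delta>)"
  define B where "B = {n \<in> {1..N}. n dvd M * \<Prod>P} - D"
  have D: "D \<subseteq> {1..N}"
  proof
    fix n assume "n \<in> D"
    then consider "n \<in> \<Delta>" | p m where "p \<in> P" "m \<in> \<Delta>" "n = p * m" unfolding D_def by blast
    then show "n \<in> {1..N}"
    proof cases
      case 1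
      have "4 ^ J \<le> X * 4 ^ J" using Xpos by simp
      then have "n \<le> N" using \<Delta>(3)[OF 1] X4 by linarith
      then show ?thesis using \<Delta>(2)[OF 1] by simp
    next
      case 2
      have "p * m \<le> X * 4 ^ J" using P[OF 2(1)] \<Delta>[OF 2(2)] by (intro mult_le_mono) auto
      then show ?thesis using \<Delta>[OF 2(2)] P[OF 2(1)] X4 2(3) by (auto simp: Suc_le_eq)
    qed
  qed
  have completes: "\<exists>T \<subseteq> {1..N} - B. (\<Sum>s\<in>S. 1 / real s) + (\<Sum>t\<in>T. 1 / real t) = 1"
    if S: "S \<subseteq> B" "(\<Sum>s\<in>S. 1 / real s) \<le> 1 - real (Suc k) * real (1 + 2 * I) / 2 ^ J" for S
  proof -
    let ?L = "M * \<Prod>P"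
    define r where "r = 1 - (\<Sum>s\<in>S. 1 / real s)"
    have "0 < ?L" using Mpos Ppos by simp
    then have Lpos: "0 < real ?L" by (simp only: of_nat_0_less_iff)
    have "(\<Sum>s\<in>S. 1 / real s) = (\<Sum>s\<in>S. real (?L div s) / real ?L)"
    proof (rule sum.cong[OF refl])
      fix s assume "s \<in> S"
      then have "s dvd ?L" "1 \<le> s" using S(1) by (auto simp: B_def)
      then have "real (?L div s) = real ?L / real s" by (intro real_of_nat_div)
      then show "1 / real s = real (?L div s) / real ?L" using Lpos by (simp del: of_nat_mult of_nat_prod)
    qed
    also have "\<dots> = (\<Sum>s\<in>S. real (?L div s)) / real ?L" by (rule sum_divide_distrib[symmetric])
    finally have "r = 1 - (\<Sum>s\<in>S. real (?L div s)) / real ?L" unfolding r_def by (simp only:)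
    also have "\<dots> = (real ?L - (\<Sum>s\<in>S. real (?L div s))) / real ?L"
      unfolding diff_divide_distrib divide_self[OF less_imp_neq[OF Lpos, symmetric]] ..
    also have "real ?L - (\<Sum>s\<in>S. real (?L div s)) = real_of_int (int ?L - (\<Sum>s\<in>S. int (?L div s)))"
      by (simp only: of_int_diff of_int_of_nat_eq of_int_sum)
    finally have "r = real_of_int (int ?L - (\<Sum>s\<in>S. int (?L div s))) / real ?L" .
    moreover have "r \<le> 1" by (simp add: r_def sum_nonneg)
    moreover have "real (k * Y) / real M + (\<Sum>p\<in>P. real (k * Y + p) / (real M * real p)) \<le> r"
    proof -
      \<comment> \<open>The dyadic estimate from \<open>2\<close> upwards bounds this sum by \<open>O(log N)\<close>, and the factor \<open>2 ^ J\<close>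
          in the denominator outweighs that.\<close>
      have "(\<Sum>p\<in>P. 1 / real p) \<le> (\<Sum>p | prime p \<and> 2 ^ 1 < p \<and> p \<le> (2::nat) ^ a. 1 / real p)"
      proof (rule sum_mono2)
        show "finite {p. prime p \<and> 2 ^ 1 < p \<and> p \<le> (2::nat) ^ a}"
          by (rule finite_subset[of _ "{..2 ^ a}"]) auto
        show "P \<subseteq> {p. prime p \<and> 2 ^ 1 < p \<and> p \<le> (2::nat) ^ a}"
          using assms(3) unfolding P_def X_def by (simp add: Collect_mono)
      qed simp
      also have "\<dots> \<le> 2 * real (a - 1) / real 1"
        using a by (intro sum_reciprocal_primes_dyadic_le) auto
      also have "\<dots> \<le> 2 * real I" using I by simp
      finally have rec: "(\<Sum>p\<in>P. 1 / real p) \<le> 2 * real I" .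
      have "(\<Sum>p\<in>P. real (k * Y + p) / (real M * real p)) \<le> (\<Sum>p\<in>P. real (Suc k) / 2 ^ J * (1 / real p))"
      proof (rule sum_mono)
        fix p assume p: "p \<in> P"
        have "k * Y + p \<le> Suc k * Y" using P[OF p] XY by simp
        then have "real (k * Y + p) \<le> real (Suc k * Y)" by (simp only: of_nat_le_iff)
        then have "real (k * Y + p) / (real M * real p) \<le> real (Suc k * Y) / (real M * real p)"
          by (intro divide_right_mono) auto
        also have "\<dots> = real (Suc k) / 2 ^ J * (1 / real p)"
          unfolding M_def of_nat_mult of_nat_power using Ypos by simp
        finally show "real (k * Y + p) / (real M * real p) \<le> real (Suc k) / 2 ^ J * (1 / real p)" .
      qed
      also have "\<dots> = real (Suc k) / 2 ^ J * (\<Sum>p\<in>P. 1 / real p)" by (rule sum_distrib_left[symmetric])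
      also have "\<dots> \<le> real (Suc k) / 2 ^ J * (2 * real I)" using rec by (intro mult_left_mono) auto
      finally have sum: "(\<Sum>p\<in>P. real (k * Y + p) / (real M * real p)) \<le> real (Suc k) / 2 ^ J * (2 * real I)" .
      have "real (k * Y) / real M = real k / 2 ^ J" using Ypos by (simp add: M_def)
      also have "\<dots> \<le> real (Suc k) / 2 ^ J" by (intro divide_right_mono) auto
      finally have "real (k * Y) / real M + (\<Sum>p\<in>P. real (k * Y + p) / (real M * real p))
        \<le> real (Suc k) / 2 ^ J + real (Suc k) / 2 ^ J * (2 * real I)" using sum by linarith
      also have "\<dots> = real (Suc k) * real (1 + 2 * I) / 2 ^ J" by (simp add: field_simps)
      finally show ?thesis using S(2) by (simp add: r_def)
    qed
    ultimately obtain T where "T \<subseteq> D" "(\<Sum>t\<in>T. 1 / real t) = r"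
      using egyptian_fraction_clearing_primes[OF finP rep Mpos card\<Delta>(1) \<Delta>(1) Pcond]
      unfolding D_def by blast
    then show ?thesis using D by (intro exI[of _ T]) (auto simp: B_def r_def)
  qed

  have bad: "real (card {n \<in> {1..N}. \<not> n dvd M * \<Prod>P})
    \<le> real N * (1 / 2 ^ Suc J + real k / 2 ^ J + 1 / real z + 6 / real (K - 2))"
  proof -
    define A1 where "A1 = {(2::nat) ^ Suc J}"
    define A2 where "A2 = (\<lambda>r. r ^ Suc (e r)) ` R"
    define A3 where "A3 = (\<lambda>d. d\<^sup>2) ` {z<..max z N}"
    define A4 where "A4 = {p. prime p \<and> 2 ^ a < p \<and> p \<le> (2::nat) ^ Suc I}"
    have fin: "finite A1" "finite A2" "finite A3" "finite A4"
      using finR by (auto simp: A1_def A2_def A3_def A4_def intro: finite_subset[of _ "{..2 ^ Suc I}"])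
    have "{n \<in> {1..N}. \<not> n dvd M * \<Prod>P} \<subseteq> {n \<in> {1..N}. \<exists>d\<in>A1 \<union> A2 \<union> A3 \<union> A4. d dvd n}"
    proof (rule subsetI, rule ccontr)
      fix n assume n: "n \<in> {n \<in> {1..N}. \<not> n dvd M * \<Prod>P}"
        and "n \<notin> {n \<in> {1..N}. \<exists>d\<in>A1 \<union> A2 \<union> A3 \<union> A4. d dvd n}"
      then have none: "\<not> d dvd n" if "d \<in> A1 \<union> A2 \<union> A3 \<union> A4" for d using that by blast
      have "n dvd M * \<Prod>P"
        unfolding M_def Y P_def R_def
      proof (rule dvd_modulus_if_no_large_factors)
        show "0 < n" "2 \<le> z" using n assms by auto
        show "\<not> 2 ^ Suc J dvd n" by (rule none) (simp add: A1_def)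
        show "\<not> r ^ Suc (e r) dvd n" if "r \<in> {p. prime p \<and> odd p \<and> p \<le> z}" for r
          using that by (intro none) (auto simp: A2_def R_def)
        show "\<not> d\<^sup>2 dvd n" if "z < d" for d
        proof
          assume d: "d\<^sup>2 dvd n"
          then have "d\<^sup>2 \<le> N" using n by (auto dest: dvd_imp_le)
          moreover have "d \<le> d\<^sup>2" by (simp add: power2_eq_square)
          ultimately have "d\<^sup>2 \<in> A3" using that by (auto simp: A3_def)
          then show False using none d by blast
        qed
        show "\<not> p dvd n" if "prime p" "X < p" for p
        proof
          assume d: "p dvd n"
          then have "p \<le> N" using n by (auto dest: dvd_imp_le)
          then have "p \<in> A4" using that assms(9) by (simp add: A4_def X_def)
          then show False using none d by blast
        qed
      qed
      then show False using n by simp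
    qed
    then have "real (card {n \<in> {1..N}. \<not> n dvd M * \<Prod>P}) \<le> real (card {n \<in> {1..N}. \<exists>d\<in>A1 \<union> A2 \<union> A3 \<union> A4. d dvd n})"
      by (intro of_nat_mono card_mono) auto
    also have "\<dots> \<le> real N * (\<Sum>d\<in>A1 \<union> A2 \<union> A3 \<union> A4. 1 / real d)"
    proof (rule card_multiples_le)
      show "0 \<notin> A1 \<union> A2 \<union> A3 \<union> A4"
        using R(3)[of 0] by (auto simp: A1_def A2_def A3_def A4_def)
    qed (use fin in auto)
    also have "\<dots> \<le> real N * (1 / 2 ^ Suc J + real k / 2 ^ J + 1 / real z + 6 / real (K - 2))"
    proof (rule mult_left_mono)
      have un: "(\<Sum>d\<in>A \<union> A'. 1 / real d) \<le> (\<Sum>d\<in>A. 1 / real d) + (\<Sum>d\<in>A'. 1 / real d)"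
        if "finite A" "finite A'" for A A' :: "nat set"
        using sum.union_inter[OF that, of "\<lambda>d. 1 / real d"] sum_nonneg[of "A \<inter> A'" "\<lambda>d. 1 / real d"] by simp
      have s1: "(\<Sum>d\<in>A1. 1 / real d) = 1 / 2 ^ Suc J" by (simp add: A1_def)
      have s2: "(\<Sum>d\<in>A2. 1 / real d) \<le> real k / 2 ^ J"
      proof -
        have "(\<Sum>d\<in>A2. 1 / real d) \<le> real (card A2) * (1 / 2 ^ J)"
        proof (rule sum_bounded_above)
          fix d assume "d \<in> A2"
          then have "2 ^ J < d" using e by (auto simp: A2_def)
          then have "real (2 ^ J) \<le> real d" by (simp only: of_nat_le_iff)
          then show "1 / real d \<le> 1 / 2 ^ J" by (simp add: frac_le)
        qed
        also have "\<dots> \<le> real k * (1 / 2 ^ J)"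
          using card_image_le[OF finR, of "\<lambda>r. r ^ Suc (e r)"] unfolding A2_def k_def R_def[symmetric]
          by (intro mult_right_mono) auto
        finally show ?thesis by simp
      qed
      have s3: "(\<Sum>d\<in>A3. 1 / real d) \<le> 1 / real z"
      proof -
        have "inj_on (\<lambda>d. d\<^sup>2) {z<..max z N}" by (auto intro!: inj_onI simp: power2_eq_iff)
        then have "(\<Sum>d\<in>A3. 1 / real d) = (\<Sum>d\<in>{z<..max z N}. 1 / (real d)\<^sup>2)"
          by (simp add: A3_def sum.reindex)
        also have "\<dots> \<le> 1 / real z - 1 / real (max z N)"
          using assms(3) by (intro sum_reciprocal_squares_le) auto
        also have "\<dots> \<le> 1 / real z" by simp
        finally show ?thesis .
      qed
      have s4: "(\<Sum>d\<in>A4. 1 / real d) \<le> 6 / real (K - 2)"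
      proof -
        have "(\<Sum>d\<in>A4. 1 / real d) \<le> 2 * real (Suc I - a) / real a"
          unfolding A4_def using a I by (intro sum_reciprocal_primes_dyadic_le) auto
        also have "\<dots> \<le> 6 * real J / real a"
          using I assms(7) by (intro divide_right_mono) auto
        also have "\<dots> \<le> 6 * real J / (real (K - 2) * real J)"
        proof (rule divide_left_mono)
          have "(K - 2) * J \<le> a" using KJ(1) by (simp add: a_def diff_mult_distrib)
          then show "real (K - 2) * real J \<le> real a" by (simp only: of_nat_mult[symmetric] of_nat_le_iff)
        qed (use assms a in auto)
        also have "\<dots> = 6 / real (K - 2)" using assms(7) by simp
        finally show ?thesis .
      qed
      show "(\<Sum>d\<in>A1 \<union> A2 \<union> A3 \<union> A4. 1 / real d) \<le> 1 / 2 ^ Suc J + real k / 2 ^ J + 1 / real z + 6 / real (K - 2)"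
        using un[of "A1 \<union> A2 \<union> A3" A4] un[of "A1 \<union> A2" A3] un[of A1 A2] fin s1 s2 s3 s4
        by (simp del: power_Suc)
    qed auto
    finally show ?thesis .
  qed
  have cardD: "real (card D) \<le> real N * (2 * real (Suc k) / 2 ^ J)"
  proof -
    have "card D \<le> card \<Delta> + card (\<Union>p\<in>P. (*) p ` \<Delta>)" unfolding D_def by (rule card_Un_le)
    also have "card (\<Union>p\<in>P. (*) p ` \<Delta>) \<le> (\<Sum>p\<in>P. card \<Delta>)"
      using card\<Delta>(1) by (intro order.trans[OF card_UN_le[OF finP]] sum_mono card_image_le)
    also have "(\<Sum>p\<in>P. card \<Delta>) \<le> X * card \<Delta>"
      using card_mono[of "{1..X}" P] P by (auto intro!: mult_right_mono simp: Suc_le_eq subset_iff)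
    also have "card \<Delta> + X * card \<Delta> \<le> 2 * X * card \<Delta>" using Xpos by (cases X) auto
    also have "\<dots> \<le> 2 * X * (Suc k * 2 ^ J)"
    proof (rule mult_left_mono)
      have "Suc J \<le> 2 ^ J" using less_exp[of J] by (simp only: Suc_le_eq)
      then have "Suc k * Suc J \<le> Suc k * 2 ^ J" by (intro mult_left_mono) auto
      then show "card \<Delta> \<le> Suc k * 2 ^ J" using card\<Delta>(2) by linarith
    qed auto
    finally have "real (card D) \<le> real (2 * X * (Suc k * 2 ^ J))" by (simp only: of_nat_le_iff)
    also have "\<dots> = real (X * 4 ^ J) * (2 * real (Suc k) / 2 ^ J)"
      by (simp add: field_simps flip: power_mult_distrib)
    also have "\<dots> \<le> real N * (2 * real (Suc k) / 2 ^ J)"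
      using X4 by (intro mult_right_mono) (simp_all only: of_nat_le_iff, simp)
    finally show ?thesis .
  qed
  have "{1..N} - B \<subseteq> {n \<in> {1..N}. \<not> n dvd M * \<Prod>P} \<union> D" by (auto simp: B_def)
  then have "card ({1..N} - B) \<le> card ({n \<in> {1..N}. \<not> n dvd M * \<Prod>P} \<union> D)"
    using finite_subset[OF D] by (intro card_mono) auto
  also have "\<dots> \<le> card {n \<in> {1..N}. \<not> n dvd M * \<Prod>P} + card D" by (rule card_Un_le)
  finally have "real (card ({1..N} - B)) \<le> real (card {n \<in> {1..N}. \<not> n dvd M * \<Prod>P}) + real (card D)"
    by (simp only: of_nat_add[symmetric] of_nat_le_iff)
  also have "\<dots> \<le> real N * (1 / 2 ^ Suc J + real k / 2 ^ J + 1 / real z + 6 / real (K - 2))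
    + real N * (2 * real (Suc k) / 2 ^ J)" using bad cardD by linarith
  also have "\<dots> \<le> real N * (3 * real (Suc k) / 2 ^ J + 1 / real z + 6 / real (K - 2))"
    unfolding distrib_left[symmetric]
  proof (rule mult_left_mono)
    have "1 / 2 ^ Suc J + real k / 2 ^ J + 2 * real (Suc k) / 2 ^ J \<le> 3 * real (Suc k) / 2 ^ J"
      by (simp add: field_simps)
    from add_right_mono[OF this, of "1 / real z + 6 / real (K - 2)"]
    show "1 / 2 ^ Suc J + real k / 2 ^ J + 1 / real z + 6 / real (K - 2) + 2 * real (Suc k) / 2 ^ J
      \<le> 3 * real (Suc k) / 2 ^ J + 1 / real z + 6 / real (K - 2)" by (simp only: ac_simps)
  qed auto
  finally have card: "real (card ({1..N} - B)) \<le> real N * (3 * real (Suc k) / 2 ^ J + 1 / real z + 6 / real (K - 2))" .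
  have "B \<subseteq> {1..N}" unfolding B_def by blast
  then show ?thesis using card completes by blast
qed

text \<open>
  First \<open>K\<close> and \<open>z\<close> are chosen in terms of \<open>\<kappa>\<close>, with at least \<open>K\<close> odd primes below \<open>z\<close>. Every other
  error term then tends to \<open>0\<close> as \<open>J = \<lfloor>log\<^sub>2 N\<rfloor> div K\<close> tends to infinity.
\<close>

lemma eventually_completable_set:
  assumes "0 < \<kappa>"
  shows "\<forall>\<^sub>F N in sequentially. \<exists>B \<subseteq> {1..N}. real (card ({1..N} - B)) \<le> \<kappa> * real N \<and>
    (\<forall>S \<subseteq> B. (\<Sum>s\<in>S. 1 / real s) \<le> 1 - \<kappa> \<longrightarrow>
      (\<exists>T \<subseteq> {1..N} - B. (\<Sum>s\<in>S. 1 / real s) + (\<Sum>t\<in>T. 1 / real t) = 1))"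
proof -
  obtain K0 :: nat where "18 / \<kappa> < real K0" using reals_Archimedean2 by blast
  define K where "K = K0 + 3"
  have K: "3 \<le> K" "18 / \<kappa> \<le> real (K - 2)" using \<open>18 / \<kappa> < real K0\<close> by (auto simp: K_def)
  then have K6: "6 / real (K - 2) \<le> \<kappa> / 3" using assms by (simp add: field_simps)
  obtain z1 :: nat where z1: "3 / \<kappa> < real z1" using reals_Archimedean2 by blast
  have "{p::nat. prime p} \<subseteq> insert 2 {p. prime p \<and> odd p}"
  proof
    fix p :: nat assume "p \<in> {p. prime p}"
    then show "p \<in> insert 2 {p. prime p \<and> odd p}"
      using prime_odd_nat[of p] prime_ge_2_nat[of p] by (cases "p = 2") auto
  qed
  then have "infinite {p::nat. prime p \<and> odd p}"
    using primes_infinite by (metis finite_insert finite_subset)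
  then obtain W where W: "finite W" "card W = K" "W \<subseteq> {p::nat. prime p \<and> odd p}"
    using infinite_arbitrarily_large by blast
  define z where "z = Max (insert (z1 + 2) W)"
  have z_ge: "p \<le> z" if "p \<in> insert (z1 + 2) W" for p
    unfolding z_def using W(1) that by (intro Max_ge) auto
  have z: "2 \<le> z" "z1 \<le> z" "\<And>p. p \<in> W \<Longrightarrow> p \<le> z"
  proof -
    have "z1 + 2 \<le> z" by (rule z_ge) simp
    then show "2 \<le> z" "z1 \<le> z" by linarith+
    show "p \<le> z" if "p \<in> W" for p using that by (intro z_ge) simp
  qed
  then have z3: "1 / real z \<le> \<kappa> / 3"
  proof -
    have "3 / \<kappa> < real z" using z1 z(2) by linarith
    then show ?thesis using assms z(1) by (simp add: field_simps)
  qed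
  define R where "R = {p. prime p \<and> odd p \<and> p \<le> z}"
  define k where "k = card R"
  have "finite R" by (auto simp: R_def intro: finite_subset[of _ "{..z}"])
  then have Kk: "K \<le> k" using W z(3) unfolding W(2)[symmetric] k_def by (intro card_mono) (auto simp: R_def)
  \<comment> \<open>Abstract real parameters keep the limits below free of casts and products.\<close>
  define C where "C = real k"
  define Q where "Q = real (\<Prod>R * 2 ^ K)"
  have "\<forall>\<^sub>F J in sequentially. 3 * (C + 1) / 2 ^ J \<le> \<kappa> / 3" using assms by real_asymp
  moreover have "\<forall>\<^sub>F J in sequentially. (C + 1) * (1 + 2 * (real K * real J + real K)) / 2 ^ J \<le> \<kappa>"
    using assms by real_asymp
  moreover have "\<forall>\<^sub>F J in sequentially. real z \<le> 2 ^ J" by real_asymp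
  moreover have "\<forall>\<^sub>F J in sequentially. C + 1 \<le> 2 ^ J" by real_asymp
  moreover have "\<forall>\<^sub>F J in sequentially. Q \<le> 4 ^ J" by real_asymp
  ultimately have "\<forall>\<^sub>F J in sequentially. 3 * (C + 1) / 2 ^ J \<le> \<kappa> / 3 \<and>
    (C + 1) * (1 + 2 * (real K * real J + real K)) / 2 ^ J \<le> \<kappa> \<and> real z \<le> 2 ^ J \<and> C + 1 \<le> 2 ^ J \<and> Q \<le> 4 ^ J \<and> 1 \<le> J"
    using eventually_ge_at_top[of 1] by eventually_elim blast
  then obtain J0 where J0: "\<And>J. J0 \<le> J \<Longrightarrow> 3 * (C + 1) / 2 ^ J \<le> \<kappa> / 3 \<and>
    (C + 1) * (1 + 2 * (real K * real J + real K)) / 2 ^ J \<le> \<kappa> \<and> real z \<le> 2 ^ J \<and> C + 1 \<le> 2 ^ J \<and> Q \<le> 4 ^ J \<and> 1 \<le> J"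
    unfolding eventually_sequentially by blast
  have "\<exists>B \<subseteq> {1..N}. real (card ({1..N} - B)) \<le> \<kappa> * real N \<and>
    (\<forall>S \<subseteq> B. (\<Sum>s\<in>S. 1 / real s) \<le> 1 - \<kappa> \<longrightarrow>
      (\<exists>T \<subseteq> {1..N} - B. (\<Sum>s\<in>S. 1 / real s) + (\<Sum>t\<in>T. 1 / real t) = 1))" if N: "2 ^ (K * J0) \<le> N" for N
  proof -
    have "1 \<le> N" using N by (meson one_le_numeral one_le_power order.trans)
    then obtain I where I: "2 ^ I \<le> N" "N < 2 ^ Suc I" using ex_power_ivl1[of 2 N] by auto
    have "(2::nat) ^ (K * J0) < 2 ^ Suc I" using N I by linarith
    then have "K * J0 < Suc I" by (simp only: power_strict_increasing_iff)
    define J where "J = I div K"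
    have "J0 \<le> J" using \<open>K * J0 < Suc I\<close> K unfolding J_def
      by (simp add: less_eq_div_iff_mult_less_eq mult.commute)
    note J = J0[OF this]
    have nat_J: "z \<le> 2 ^ J" "Suc k \<le> 2 ^ J" "\<Prod>R * 2 ^ K \<le> 4 ^ J"
    proof -
      have "real z \<le> real (2 ^ J)" "real (Suc k) \<le> real (2 ^ J)" "real (\<Prod>R * 2 ^ K) \<le> real (4 ^ J)"
        using J unfolding C_def Q_def by (simp_all add: add.commute)
      then show "z \<le> 2 ^ J" "Suc k \<le> 2 ^ J" "\<Prod>R * 2 ^ K \<le> 4 ^ J" by (simp_all only: of_nat_le_iff)
    qed
    have IK: "I \<le> K * J + K" using dividend_less_times_div[of K I] K unfolding J_def by linarith
    have \<kappa>1: "real (Suc k) * real (1 + 2 * I) / 2 ^ J \<le> \<kappa>"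
    proof -
      have "real (1 + 2 * I) \<le> real (1 + 2 * (K * J + K))" using IK by (simp only: of_nat_le_iff) simp
      then have "real (Suc k) * real (1 + 2 * I) / 2 ^ J \<le> real (Suc k) * real (1 + 2 * (K * J + K)) / 2 ^ J"
        by (intro divide_right_mono mult_left_mono) auto
      also have "\<dots> = (C + 1) * (1 + 2 * (real K * real J + real K)) / 2 ^ J" by (simp add: C_def)
      finally show ?thesis using J by linarith
    qed
    have \<kappa>2: "real N * (3 * real (Suc k) / 2 ^ J + 1 / real z + 6 / real (K - 2)) \<le> \<kappa> * real N"
    proof -
      have "3 * real (Suc k) / 2 ^ J = 3 * (C + 1) / 2 ^ J" by (simp add: C_def)
      then have "3 * real (Suc k) / 2 ^ J \<le> \<kappa> / 3" using J by (simp only:)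
      then have "3 * real (Suc k) / 2 ^ J + 1 / real z + 6 / real (K - 2) \<le> \<kappa> / 3 + \<kappa> / 3 + \<kappa> / 3"
        using K6 z3 by (intro add_mono)
      then have "real N * (3 * real (Suc k) / 2 ^ J + 1 / real z + 6 / real (K - 2)) \<le> real N * \<kappa>"
        by (intro mult_left_mono) auto
      then show ?thesis by (simp only: mult.commute)
    qed
    obtain B where B: "B \<subseteq> {1..N}"
      "real (card ({1..N} - B)) \<le> real N * (3 * real (Suc k) / 2 ^ J + 1 / real z + 6 / real (K - 2))"
      "\<And>S. S \<subseteq> B \<Longrightarrow> (\<Sum>s\<in>S. 1 / real s) \<le> 1 - real (Suc k) * real (1 + 2 * I) / 2 ^ J \<Longrightarrow>
        \<exists>T \<subseteq> {1..N} - B. (\<Sum>s\<in>S. 1 / real s) + (\<Sum>t\<in>T. 1 / real t) = 1"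
      using completable_set_explicit[OF z(1) K(1) Kk[unfolded k_def R_def] J_def _ I nat_J(1)
          nat_J(2)[unfolded k_def R_def] nat_J(3)[unfolded R_def]] J
      unfolding k_def R_def by blast
    have "real (card ({1..N} - B)) \<le> \<kappa> * real N" using B(2) \<kappa>2 by linarith
    moreover have "\<exists>T \<subseteq> {1..N} - B. (\<Sum>s\<in>S. 1 / real s) + (\<Sum>t\<in>T. 1 / real t) = 1"
      if "S \<subseteq> B" "(\<Sum>s\<in>S. 1 / real s) \<le> 1 - \<kappa>" for S
    proof (rule B(3)[OF that(1)])
      show "(\<Sum>s\<in>S. 1 / real s) \<le> 1 - real (Suc k) * real (1 + 2 * I) / 2 ^ J"
        using that(2) \<kappa>1 by linarith
    qed
    ultimately show ?thesis using B(1) by blast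
  qed
  then show ?thesis unfolding eventually_sequentially by blast
qed

lemma finite_unit_fraction_sets: "finite (unit_fraction_sets N)"
  by (rule finite_subset[of _ "Pow {1..N}"]) (auto simp: unit_fraction_sets_def)

text \<open>
  Adding the completion is injective, since \<open>S\<close> is recovered by intersecting with \<open>B\<close>.
\<close>

lemma card_completable_le:
  assumes "A \<subseteq> B" "B \<subseteq> {1..N}"
    and "\<And>S. S \<subseteq> B \<Longrightarrow> P S \<Longrightarrow> \<exists>T \<subseteq> {1..N} - B. (\<Sum>s\<in>S. 1 / real s) + (\<Sum>t\<in>T. 1 / real t) = 1"
  shows "card {S. S \<subseteq> A \<and> P S} \<le> card (unit_fraction_sets N)"
proof -
  define T where "T S = (SOME T. T \<subseteq> {1..N} - B \<and> (\<Sum>s\<in>S. 1 / real s) + (\<Sum>t\<in>T. 1 / real t) = 1)" for S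
  have T: "T S \<subseteq> {1..N} - B" "(\<Sum>s\<in>S. 1 / real s) + (\<Sum>t\<in>T S. 1 / real t) = 1"
    if "S \<subseteq> A" "P S" for S
  proof -
    have "S \<subseteq> B" using that(1) assms(1) by (rule order.trans)
    then have "T S \<subseteq> {1..N} - B \<and> (\<Sum>s\<in>S. 1 / real s) + (\<Sum>t\<in>T S. 1 / real t) = 1"
      unfolding T_def by (rule someI_ex[OF assms(3)[OF _ that(2)]])
    then show "T S \<subseteq> {1..N} - B" "(\<Sum>s\<in>S. 1 / real s) + (\<Sum>t\<in>T S. 1 / real t) = 1" by blast+
  qed
  show ?thesis
  proof (rule card_inj_on_le)
    show "inj_on (\<lambda>S. S \<union> T S) {S. S \<subseteq> A \<and> P S}"
    proof (rule inj_onI)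
      fix S S' assume S: "S \<in> {S. S \<subseteq> A \<and> P S}" "S' \<in> {S. S \<subseteq> A \<and> P S}" "S \<union> T S = S' \<union> T S'"
      have "(S \<union> T S) \<inter> B = S" "(S' \<union> T S') \<inter> B = S'"
        using S(1,2) T(1)[of S] T(1)[of S'] assms(1) by blast+
      then show "S = S'" unfolding S(3) by (rule trans[OF sym])
    qed
    show "(\<lambda>S. S \<union> T S) ` {S. S \<subseteq> A \<and> P S} \<subseteq> unit_fraction_sets N"
    proof (rule image_subsetI)
      fix S assume "S \<in> {S. S \<subseteq> A \<and> P S}"
      then have S: "S \<subseteq> A" "P S" by simp_all
      have "S \<subseteq> B" using S(1) assms(1) by (rule order.trans)
      then have sub: "S \<subseteq> {1..N}" "T S \<subseteq> {1..N}" "S \<inter> T S = {}" using T(1)[OF S] assms(2) by blast+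
      then have "finite S" "finite (T S)" by (auto intro: finite_subset)
      then have "(\<Sum>s\<in>S \<union> T S. 1 / real s) = 1"
        using T(2)[OF S] sum.union_disjoint[of S "T S" "\<lambda>s. 1 / real s"] sub(3) by simp
      then show "S \<union> T S \<in> unit_fraction_sets N" using sub by (simp add: unit_fraction_sets_def)
    qed
  qed (rule finite_unit_fraction_sets)
qed

section \<open>The number of sets with reciprocal sum one\<close>

lemma tilted_variance_le:
  assumes "0 < l" "1 \<le> N" "A \<subseteq> {1..N}"
  shows "tilted_variance (\<lambda>n. exp (- (l * real N) * (1 / real n))) (\<lambda>n. 1 / real n) A \<le> 2 / l\<^sup>2 / real N"
proof -
  have "tilted_variance (\<lambda>n. exp (- (l * real N) * (1 / real n))) (\<lambda>n. 1 / real n) A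
      \<le> (\<Sum>n\<in>A. 2 / (l * real N)\<^sup>2)"
    unfolding tilted_variance_def
  proof (rule sum_mono)
    fix n assume "n \<in> A"
    then have n: "0 < real n" using assms(3) by auto
    let ?w = "exp (- (l * real N) * (1 / real n))"
    have "?w / (1 + ?w)\<^sup>2 \<le> ?w"
    proof -
      have "1 \<le> (1 + ?w)\<^sup>2" by (simp add: one_le_power)
      then show ?thesis by (simp add: divide_le_eq mult_le_cancel_left1)
    qed
    also have "?w \<le> 2 / (l * real N / real n)\<^sup>2"
      using exp_minus_le_square[of "l * real N / real n"] assms n by simp
    finally have "?w / (1 + ?w)\<^sup>2 * (1 / real n)\<^sup>2 \<le> 2 / (l * real N / real n)\<^sup>2 * (1 / real n)\<^sup>2"
      by (rule mult_right_mono) simp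
    also have "\<dots> = 2 / (l * real N)\<^sup>2" using n by (simp add: power_divide)
    finally show "?w / (1 + ?w)\<^sup>2 * (1 / real n)\<^sup>2 \<le> 2 / (l * real N)\<^sup>2" .
  qed
  also have "\<dots> = real (card A) * (2 / (l * real N)\<^sup>2)" by simp
  also have "\<dots> \<le> real N * (2 / (l * real N)\<^sup>2)"
    using card_mono[OF _ assms(3)] by (intro mult_right_mono) auto
  also have "\<dots> = 2 / l\<^sup>2 / real N" using assms by (simp add: power2_eq_square)
  finally show ?thesis .
qed

lemma reciprocal_density_ge:
  assumes "0 < l" "1 / 2 \<le> x" "x \<le> 1"
  shows "1 / (1 + exp (2 * l)) \<le> reciprocal_density l x"
proof -
  have "l / x \<le> 2 * l" using assms by (simp add: field_simps)
  then have "1 / (1 + exp (2 * l)) \<le> 1 / (1 + exp (l / x))"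
    by (intro divide_left_mono mult_pos_pos add_pos_pos) auto
  also have "\<dots> \<le> 1 / (1 + exp (l / x)) * (1 / x)"
  proof -
    have "1 / (1 + exp (l / x)) * 1 \<le> 1 / (1 + exp (l / x)) * (1 / x)"
      using assms by (intro mult_left_mono) (auto intro: add_nonneg_nonneg)
    then show ?thesis by simp
  qed
  also have "1 / (1 + exp (l / x)) = exp (- l / x) / (1 + exp (- l / x))"
    using add_pos_pos[of 1 "exp (l / x)"] add_pos_pos[of 1 "exp (- l / x)"] by (simp add: exp_minus field_simps)
  finally show ?thesis by (simp only: reciprocal_density_def)
qed

lemma card_top_segment:
  fixes N :: nat and \<tau> :: real
  assumes "0 \<le> \<tau>" "\<tau> \<le> 1"
  shows "\<tau> * real N \<le> real (card {n \<in> {1..N}. (1 - \<tau>) * real N < real n})"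
    and "real (card {n \<in> {1..N}. (1 - \<tau>) * real N < real n}) \<le> \<tau> * real N + 1"
proof -
  define m where "m = nat \<lfloor>(1 - \<tau>) * real N\<rfloor>"
  have nn: "0 \<le> (1 - \<tau>) * real N" using assms by simp
  have m: "real m \<le> (1 - \<tau>) * real N" "(1 - \<tau>) * real N < real m + 1"
    using nn by (auto simp: m_def)
  have "(1 - \<tau>) * real N \<le> 1 * real N" using assms by (intro mult_right_mono) auto
  then have "m \<le> N" using m(1) by linarith
  have above: "(1 - \<tau>) * real N < real n \<longleftrightarrow> m < n" for n
  proof
    assume "m < n"
    then have "real m + 1 \<le> real n" by linarith
    then show "(1 - \<tau>) * real N < real n" using m by linarith
  qed (use m in linarith)
  then have top: "{n \<in> {1..N}. (1 - \<tau>) * real N < real n} = {m<..N}" unfolding above by auto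
  have "real (card {n \<in> {1..N}. (1 - \<tau>) * real N < real n}) = real N - real m"
    unfolding top using \<open>m \<le> N\<close> by simp
  moreover have "(1 - \<tau>) * real N = real N - \<tau> * real N" by (simp add: algebra_simps)
  ultimately show "\<tau> * real N \<le> real (card {n \<in> {1..N}. (1 - \<tau>) * real N < real n})"
    "real (card {n \<in> {1..N}. (1 - \<tau>) * real N < real n}) \<le> \<tau> * real N + 1"
    using m by linarith+
qed

text \<open>
  Besides the integers outside \<open>B\<close>, those in the top segment \<open>((1 - \<tau>) N, N]\<close> are removed. There the
  density is at least \<open>c\<close>, so this lowers the mean from about \<open>1\<close> to at most about \<open>1 - c \<tau>\<close> and makes
  room for the deviation \<open>\<delta>\<close> from the mean and for the completion, which needs the sum to be at most
  \<open>1 - \<kappa>\<close>. All losses are \<open>O(\<tau>)\<close>.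
\<close>

lemma log_card_unit_fraction_sets_lower:
  assumes l: "is_lambda_star l" and "0 < \<epsilon>"
  shows "\<forall>\<^sub>F N in sequentially. l + integral {0..1} (log_partition l) - \<epsilon>
    \<le> ln (real (card (unit_fraction_sets N))) / real N"
proof -
  have lpos: "0 < l" and int1: "integral {0..1} (reciprocal_density l) = 1"
    using l by (simp_all add: is_lambda_star_def reciprocal_density_def[abs_def])
  define Lam where "Lam = integral {0..1} (log_partition l)"
  \<comment> \<open>The losses in the exponent add up to at most \<open>(8 + l) * \<tau>\<close>.\<close>
  define \<tau> where "\<tau> = min (1 / 2) (\<epsilon> / (8 + l))"
  define c where "c = 1 / (1 + exp (2 * l))"
  define \<delta> where "\<delta> = c * \<tau> / 4"
  define \<kappa> where "\<kappa> = c * \<tau> / 2"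
  have "0 < \<epsilon> / (8 + l)" using lpos \<open>0 < \<epsilon>\<close> by (intro divide_pos_pos) auto
  then have "0 < \<tau>" unfolding \<tau>_def by (metis half_gt_zero_iff min_def zero_less_one)
  moreover have "\<tau> \<le> 1 / 2" unfolding \<tau>_def by (rule min.cobounded1)
  ultimately have \<tau>: "0 < \<tau>" "\<tau> \<le> 1 / 2" .
  have "\<tau> \<le> \<epsilon> / (8 + l)" by (simp add: \<tau>_def)
  then have \<tau>\<epsilon>: "\<tau> * (8 + l) \<le> \<epsilon>" using lpos by (simp add: le_divide_eq)
  have c: "0 < c" "c \<le> 1" by (auto simp: c_def add_pos_pos divide_le_eq)
  have \<delta>: "0 < \<delta>" and \<kappa>: "0 < \<kappa>" using c \<tau> by (auto simp: \<delta>_def \<kappa>_def)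
  have "c * \<tau> \<le> 1 * \<tau>" using c \<tau> by (intro mult_right_mono) auto
  then have c\<tau>: "c * \<tau> \<le> \<tau>" by simp

  have "(\<lambda>N. (\<Sum>n=1..N. reciprocal_density l (real n / real N)) / real N) \<longlonglongrightarrow> 1"
    using riemann_sum_tendsto_integral[OF continuous_on_reciprocal_density[OF lpos]] int1 by simp
  then have ev1: "\<forall>\<^sub>F N in sequentially. \<bar>(\<Sum>n=1..N. reciprocal_density l (real n / real N)) / real N - 1\<bar> < \<delta>"
    using \<delta> by (auto dest!: tendstoD[of _ _ _ \<delta>] simp: dist_real_def)
  have "(\<lambda>N. (\<Sum>n=1..N. log_partition l (real n / real N)) / real N) \<longlonglongrightarrow> Lam"
    unfolding Lam_def by (rule riemann_sum_tendsto_integral[OF continuous_on_log_partition[OF lpos]])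
  then have ev2: "\<forall>\<^sub>F N in sequentially. \<bar>(\<Sum>n=1..N. log_partition l (real n / real N)) / real N - Lam\<bar> < \<tau>"
    using \<tau>(1) by (auto dest!: tendstoD[of _ _ _ \<tau>] simp: dist_real_def)
  have ev3: "\<forall>\<^sub>F N::nat in sequentially. 2 / l\<^sup>2 / real N \<le> \<delta>\<^sup>2 / 2" using \<delta> by real_asymp
  have ev4: "\<forall>\<^sub>F N::nat in sequentially. 1 / real N \<le> \<tau>" using \<tau> by real_asymp
  show ?thesis
    using eventually_completable_set[OF \<kappa>] ev1 ev2 ev3 ev4 eventually_ge_at_top[of 1]
  proof eventually_elim
    case (elim N)
    have N: "0 < real N" "1 \<le> N" "1 \<le> \<tau> * real N"
      using elim(5,6) by (auto simp: divide_le_eq)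
    obtain B where B: "B \<subseteq> {1..N}" "real (card ({1..N} - B)) \<le> \<kappa> * real N"
      "\<And>S. S \<subseteq> B \<Longrightarrow> (\<Sum>s\<in>S. 1 / real s) \<le> 1 - \<kappa> \<Longrightarrow>
        \<exists>T \<subseteq> {1..N} - B. (\<Sum>s\<in>S. 1 / real s) + (\<Sum>t\<in>T. 1 / real t) = 1"
      using elim(1) by blast
    define H where "H = {n \<in> {1..N}. (1 - \<tau>) * real N < real n}"
    define A where "A = B - H"
    define w where "w n = exp (- (l * real N) * (1 / real n))" for n :: nat
    define \<mu> where "\<mu> = tilted_mean w (\<lambda>n. 1 / real n) A"
    define \<rho> where "\<rho> n = reciprocal_density l (real n / real N)" for n :: nat
    define h where "h n = log_partition l (real n / real N)" for n :: nat
    have A: "A \<subseteq> {1..N}" "A \<subseteq> B" "finite A" using B(1) finite_subset by (auto simp: A_def)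
    have H: "H \<subseteq> {1..N}" "\<tau> * real N \<le> real (card H)" "real (card H) \<le> \<tau> * real N + 1"
      using card_top_segment[of \<tau> N] \<tau> unfolding H_def by auto
    have missing: "real (card ({1..N} - A)) \<le> (\<kappa> + 2 * \<tau>) * real N"
    proof -
      have "{1..N} - A \<subseteq> ({1..N} - B) \<union> H" by (auto simp: A_def)
      then have "card ({1..N} - A) \<le> card (({1..N} - B) \<union> H)"
        using H(1) by (intro card_mono) (auto intro: finite_subset)
      also have "\<dots> \<le> card ({1..N} - B) + card H" by (rule card_Un_le)
      finally have "real (card ({1..N} - A)) \<le> real (card ({1..N} - B)) + real (card H)"
        by (simp only: of_nat_add[symmetric] of_nat_le_iff)
      also have "\<dots> \<le> \<kappa> * real N + (\<tau> * real N + \<tau> * real N)" using B(2) H(3) N(3) by linarith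
      finally show ?thesis by (simp add: algebra_simps)
    qed
    have \<mu>: "\<mu> = (\<Sum>n\<in>A. \<rho> n) / real N"
      unfolding \<mu>_def tilted_mean_def w_def \<rho>_def sum_divide_distrib
      using A N by (intro sum.cong[OF refl] tilted_term_eq_density) auto
    have \<rho>0: "0 \<le> \<rho> n" for n unfolding \<rho>_def by (rule reciprocal_density_nonneg) simp
    have split: "(\<Sum>n\<in>A. \<rho> n) = (\<Sum>n=1..N. \<rho> n) - (\<Sum>n\<in>{1..N} - A. \<rho> n)"
      using sum.subset_diff[OF A(1), of \<rho>] by simp
    have mean: "\<bar>(\<Sum>n=1..N. \<rho> n) / real N - 1\<bar> < \<delta>" using elim(2) by (simp add: \<rho>_def)
    have \<mu>_upper: "\<mu> \<le> 1 + \<delta> - c * \<tau>"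
    proof -
      have "c * \<tau> * real N \<le> c * real (card H)" using H(2) c by (simp add: mult.assoc)
      also have "\<dots> = (\<Sum>n\<in>H. c)" by simp
      also have "\<dots> \<le> (\<Sum>n\<in>H. \<rho> n)"
      proof (rule sum_mono)
        fix n assume n: "n \<in> H"
        have "1 / 2 * real N \<le> (1 - \<tau>) * real N" using \<tau> by (intro mult_right_mono) auto
        also have "\<dots> < real n" using n by (simp add: H_def)
        finally have "1 / 2 \<le> real n / real N" "real n / real N \<le> 1"
          using n H(1) N by (auto simp: field_simps)
        then show "c \<le> \<rho> n" unfolding c_def \<rho>_def by (rule reciprocal_density_ge[OF lpos])
      qed
      also have "\<dots> \<le> (\<Sum>n\<in>{1..N} - A. \<rho> n)"
        using H(1) \<rho>0 by (intro sum_mono2) (auto simp: A_def)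
      finally have "\<mu> \<le> ((\<Sum>n=1..N. \<rho> n) - c * \<tau> * real N) / real N"
        unfolding \<mu> split by (intro divide_right_mono) auto
      also have "\<dots> = (\<Sum>n=1..N. \<rho> n) / real N - c * \<tau>" using N by (simp add: diff_divide_distrib)
      finally show ?thesis using mean by linarith
    qed
    have \<mu>_lower: "1 - \<delta> - (\<kappa> + 2 * \<tau>) / l \<le> \<mu>"
    proof -
      have "(\<Sum>n\<in>{1..N} - A. \<rho> n) \<le> real (card ({1..N} - A)) * (1 / l)"
        unfolding \<rho>_def by (intro sum_bounded_above reciprocal_density_le_inverse[OF lpos]) simp
      also have "\<dots> \<le> (\<kappa> + 2 * \<tau>) * real N * (1 / l)" using missing lpos by (intro mult_right_mono) auto
      finally have "((\<Sum>n=1..N. \<rho> n) - (\<kappa> + 2 * \<tau>) * real N * (1 / l)) / real N \<le> \<mu>"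
        unfolding \<mu> split by (intro divide_right_mono) auto
      moreover have "((\<Sum>n=1..N. \<rho> n) - (\<kappa> + 2 * \<tau>) * real N * (1 / l)) / real N
          = (\<Sum>n=1..N. \<rho> n) / real N - (\<kappa> + 2 * \<tau>) / l"
        using N by (simp add: diff_divide_distrib)
      ultimately show ?thesis using mean by linarith
    qed
    have Z: "exp ((Lam - \<tau> - (\<kappa> + 2 * \<tau>)) * real N) \<le> (\<Prod>n\<in>A. 1 + w n)"
    proof -
      have h1: "h n \<le> 1" for n
      proof -
        have "h n \<le> ln (1 + 1)" if "0 < real n / real N"
          using that lpos unfolding h_def log_partition_def by (auto simp: add_pos_pos)
        moreover have "ln (1 + 1) \<le> (1::real)" using ln_add_one_self_le_self[of 1] by simp
        ultimately show ?thesis by (cases "real n / real N = 0") (auto simp: h_def log_partition_def)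
      qed
      have "(\<Sum>n\<in>{1..N} - A. h n) \<le> real (card ({1..N} - A)) * 1" by (intro sum_bounded_above h1)
      then have "(\<Sum>n\<in>{1..N} - A. h n) \<le> (\<kappa> + 2 * \<tau>) * real N" using missing by linarith
      moreover have "(\<Sum>n\<in>A. h n) = (\<Sum>n=1..N. h n) - (\<Sum>n\<in>{1..N} - A. h n)"
        using sum.subset_diff[OF A(1), of h] by simp
      moreover have "(Lam - \<tau>) * real N \<le> (\<Sum>n=1..N. h n)"
      proof -
        have "Lam - \<tau> \<le> (\<Sum>n=1..N. h n) / real N" using elim(3) unfolding h_def by linarith
        then show ?thesis using N by (simp add: le_divide_eq)
      qed
      ultimately have "(Lam - \<tau> - (\<kappa> + 2 * \<tau>)) * real N \<le> (\<Sum>n\<in>A. h n)" by (simp add: algebra_simps)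
      also have "(\<Sum>n\<in>A. h n) = (\<Sum>n\<in>A. ln (1 + w n))"
        unfolding h_def w_def using A N by (intro sum.cong[OF refl] tilted_term_eq_density(2)[symmetric]) auto
      finally have "exp ((Lam - \<tau> - (\<kappa> + 2 * \<tau>)) * real N) \<le> exp (\<Sum>n\<in>A. ln (1 + w n))" by simp
      also have "\<dots> = (\<Prod>n\<in>A. 1 + w n)"
        using A(3) by (simp add: exp_sum w_def add_pos_pos)
      finally show ?thesis .
    qed
    have V: "1 / 2 \<le> 1 - tilted_variance w (\<lambda>n. 1 / real n) A / \<delta>\<^sup>2"
    proof -
      have "tilted_variance w (\<lambda>n. 1 / real n) A \<le> \<delta>\<^sup>2 / 2"
        using tilted_variance_le[OF lpos N(2) A(1)] elim(4) unfolding w_def by linarith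
      then have "tilted_variance w (\<lambda>n. 1 / real n) A / \<delta>\<^sup>2 \<le> 1 / 2" using \<delta> by (simp add: divide_le_eq)
      then show ?thesis by simp
    qed
    let ?near = "{S. S \<subseteq> A \<and> \<bar>(\<Sum>s\<in>S. 1 / real s) - \<mu>\<bar> < \<delta>}"
    have "exp ((Lam - \<tau> - (\<kappa> + 2 * \<tau>)) * real N) * (1 / 2) * exp (l * real N * (\<mu> - \<delta>))
      \<le> (\<Prod>n\<in>A. 1 + w n) * (1 - tilted_variance w (\<lambda>n. 1 / real n) A / \<delta>\<^sup>2) * exp (l * real N * (\<mu> - \<delta>))"
      using Z V by (intro mult_right_mono mult_mono) (auto simp: w_def intro!: prod_nonneg add_nonneg_nonneg)
    also have "\<dots> \<le> real (card ?near)"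
      using card_subsets_with_sum_near_mean[OF A(3), of "l * real N" \<delta> "\<lambda>n. 1 / real n"] lpos \<delta>
      unfolding \<mu>_def w_def[abs_def] by simp
    also have "real (card ?near) \<le> real (card (unit_fraction_sets N))"
    proof (rule of_nat_mono)
      have near: "\<mu> + \<delta> \<le> 1 - \<kappa>" using \<mu>_upper unfolding \<delta>_def \<kappa>_def by linarith
      show "card ?near \<le> card (unit_fraction_sets N)"
      proof (rule card_completable_le[OF A(2) B(1)])
        fix S assume "S \<subseteq> B" "\<bar>(\<Sum>s\<in>S. 1 / real s) - \<mu>\<bar> < \<delta>"
        then show "\<exists>T \<subseteq> {1..N} - B. (\<Sum>s\<in>S. 1 / real s) + (\<Sum>t\<in>T. 1 / real t) = 1"
          using near by (intro B(3)) (auto simp: abs_less_iff)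
      qed
    qed
    finally have "exp ((Lam - \<tau> - (\<kappa> + 2 * \<tau>)) * real N) * (1 / 2) * exp (l * real N * (\<mu> - \<delta>))
      \<le> real (card (unit_fraction_sets N))" .
    then have "ln (exp ((Lam - \<tau> - (\<kappa> + 2 * \<tau>)) * real N) * (1 / 2) * exp (l * real N * (\<mu> - \<delta>)))
      \<le> ln (real (card (unit_fraction_sets N)))" by (intro ln_mono) auto
    moreover have "ln (exp ((Lam - \<tau> - (\<kappa> + 2 * \<tau>)) * real N) * (1 / 2) * exp (l * real N * (\<mu> - \<delta>)))
      = (Lam - \<tau> - (\<kappa> + 2 * \<tau>)) * real N - ln 2 + l * real N * (\<mu> - \<delta>)"
      by (simp add: ln_mult ln_div)
    moreover have "ln 2 \<le> \<tau> * real N"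
      using ln_add_one_self_le_self[of 1] N(3) by simp
    ultimately have "(Lam - \<tau> - (\<kappa> + 2 * \<tau>)) * real N - \<tau> * real N + l * real N * (\<mu> - \<delta>)
      \<le> ln (real (card (unit_fraction_sets N)))" by linarith
    moreover have "(Lam - \<tau> - (\<kappa> + 2 * \<tau>)) * real N - \<tau> * real N + l * real N * (\<mu> - \<delta>)
      = (Lam - \<tau> - (\<kappa> + 2 * \<tau>) - \<tau> + l * (\<mu> - \<delta>)) * real N" by (simp add: algebra_simps)
    ultimately have "Lam - \<tau> - (\<kappa> + 2 * \<tau>) - \<tau> + l * (\<mu> - \<delta>) \<le> ln (real (card (unit_fraction_sets N))) / real N"
      using N by (simp add: le_divide_eq)
    moreover have "l * (1 - \<delta> - (\<kappa> + 2 * \<tau>) / l - \<delta>) \<le> l * (\<mu> - \<delta>)"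
      using \<mu>_lower lpos by (intro mult_left_mono) auto
    moreover have "l * (1 - \<delta> - (\<kappa> + 2 * \<tau>) / l - \<delta>) = l - 2 * (l * \<delta>) - (\<kappa> + 2 * \<tau>)"
      unfolding right_diff_distrib using lpos by simp
    moreover have "2 * (l * \<delta>) \<le> l * \<tau>"
    proof -
      have "l * (2 * \<delta>) \<le> l * \<tau>" using c\<tau> \<tau> lpos unfolding \<delta>_def by (intro mult_left_mono) auto
      then show ?thesis by simp
    qed
    moreover have "\<kappa> \<le> \<tau>" using c\<tau> \<tau> unfolding \<kappa>_def by linarith
    moreover have "\<tau> * (8 + l) = 8 * \<tau> + l * \<tau>" by (simp add: algebra_simps)
    ultimately show "l + integral {0..1} (log_partition l) - \<epsilon> \<le> ln (real (card (unit_fraction_sets N))) / real N"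
      using \<tau>\<epsilon> unfolding Lam_def[symmetric] by linarith
  qed
qed

lemma card_unit_fraction_sets_pos: "1 \<le> N \<Longrightarrow> 0 < card (unit_fraction_sets N)"
proof -
  assume "1 \<le> N"
  then have "{1} \<in> unit_fraction_sets N" by (simp add: unit_fraction_sets_def)
  then show ?thesis using finite_unit_fraction_sets by (metis card_gt_0_iff empty_iff)
qed

lemma log_card_unit_fraction_sets_upper:
  assumes "0 < l" "0 < \<epsilon>"
  shows "\<forall>\<^sub>F N in sequentially. ln (real (card (unit_fraction_sets N))) / real N
    \<le> l + integral {0..1} (log_partition l) + \<epsilon>"
proof -
  have "\<forall>\<^sub>F N in sequentially. dist ((\<Sum>n=1..N. log_partition l (real n / real N)) / real N)
      (integral {0..1} (log_partition l)) < \<epsilon>"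
    using riemann_sum_tendsto_integral[OF continuous_on_log_partition[OF assms(1)]] assms(2) by (rule tendstoD)
  then show ?thesis
    using eventually_ge_at_top[of 1]
  proof eventually_elim
    case (elim N)
    have "real (card (unit_fraction_sets N)) \<le> exp (l * real N * 1) * (\<Prod>n=1..N. 1 + exp (- (l * real N) * (1 / real n)))"
      using card_subsets_with_sum_le[of "{1..N}" "\<lambda>n. 1 / real n" 1 "l * real N"]
      unfolding unit_fraction_sets_def by simp
    moreover have "0 < real (card (unit_fraction_sets N))" using card_unit_fraction_sets_pos elim(2) by simp
    ultimately have "ln (real (card (unit_fraction_sets N)))
      \<le> ln (exp (l * real N * 1) * (\<Prod>n=1..N. 1 + exp (- (l * real N) * (1 / real n))))" by (intro ln_mono)
    also have "\<dots> = l * real N + (\<Sum>n=1..N. ln (1 + exp (- (l * real N) * (1 / real n))))"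
    proof -
      have pos: "0 < 1 + exp x" for x :: real by (rule add_pos_pos) auto
      have "0 < (\<Prod>n=1..N. 1 + exp (- (l * real N) * (1 / real n)))" by (intro prod_pos ballI pos)
      moreover have "ln (\<Prod>n=1..N. 1 + exp (- (l * real N) * (1 / real n)))
        = (\<Sum>n=1..N. ln (1 + exp (- (l * real N) * (1 / real n))))"
        using pos by (intro ln_prod finite_atLeastAtMost) (metis less_irrefl)
      ultimately show ?thesis by (simp only: ln_mult_pos exp_gt_zero ln_exp mult_1_right)
    qed
    also have "(\<Sum>n=1..N. ln (1 + exp (- (l * real N) * (1 / real n)))) = (\<Sum>n=1..N. log_partition l (real n / real N))"
      using elim(2) by (intro sum.cong[OF refl] tilted_term_eq_density(2)) auto
    finally have "ln (real (card (unit_fraction_sets N))) / real N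
      \<le> (l * real N + (\<Sum>n=1..N. log_partition l (real n / real N))) / real N" by (rule divide_right_mono) simp
    also have "\<dots> = l + (\<Sum>n=1..N. log_partition l (real n / real N)) / real N"
      using elim(2) by (simp add: add_divide_distrib)
    finally show ?case using elim(1) by (simp add: dist_real_def abs_less_iff)
  qed
qed

theorem theorem1p2:
  shows "(\<exists>!l. is_lambda_star l) \<and>
    (\<exists>f g :: nat \<Rightarrow> real. f \<in> o(\<lambda>N. real N) \<and> g \<in> o(\<lambda>N. real N) \<and>
      (\<forall>N\<ge>1. exp (gamma_star * real N - f N) \<le> real (card (unit_fraction_sets N)) \<and>
              real (card (unit_fraction_sets N)) \<le> exp (gamma_star * real N + g N)))"
proof -
  have l: "is_lambda_star lambda_star" unfolding lambda_star_def by (rule theI'[OF ex1_lambda_star])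
  then have lpos: "0 < lambda_star" by (simp add: is_lambda_star_def)
  have \<gamma>: "gamma_star = lambda_star + integral {0..1} (log_partition lambda_star)"
    by (simp only: gamma_star_def integral_log_partition)
  define c where "c N = real (card (unit_fraction_sets N))" for N
  have lim: "(\<lambda>N. ln (c N) / real N) \<longlonglongrightarrow> gamma_star"
  proof (rule tendstoI)
    fix \<epsilon> :: real assume "0 < \<epsilon>"
    then have "0 < \<epsilon> / 2" by simp
    show "\<forall>\<^sub>F N in sequentially. dist (ln (c N) / real N) gamma_star < \<epsilon>"
      using log_card_unit_fraction_sets_lower[OF l \<open>0 < \<epsilon> / 2\<close>] log_card_unit_fraction_sets_upper[OF lpos \<open>0 < \<epsilon> / 2\<close>]
      unfolding c_def \<gamma>
      by eventually_elim (use \<open>0 < \<epsilon>\<close> in \<open>simp add: dist_real_def abs_less_iff\<close>)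
  qed
  define f where "f N = \<bar>gamma_star * real N - ln (c N)\<bar>" for N
  have "f \<in> o(\<lambda>N. real N)"
  proof (rule smalloI_tendsto)
    have "(\<lambda>N. \<bar>gamma_star - ln (c N) / real N\<bar>) \<longlonglongrightarrow> 0"
      using tendsto_rabs_zero[OF LIM_zero[OF lim]] by (simp add: abs_minus_commute)
    moreover have "\<forall>\<^sub>F N in sequentially. \<bar>gamma_star - ln (c N) / real N\<bar> = f N / real N"
      using eventually_ge_at_top[of 1]
    proof eventually_elim
      case (elim N)
      then have "gamma_star - ln (c N) / real N = (gamma_star * real N - ln (c N)) / real N"
        by (simp add: diff_divide_distrib)
      then show ?case by (simp add: f_def)
    qed
    ultimately show "(\<lambda>N. f N / real N) \<longlonglongrightarrow> 0" by (rule Lim_transform_eventually)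
    show "\<forall>\<^sub>F N in sequentially. real N \<noteq> 0" using eventually_ge_at_top[of 1] by eventually_elim simp
  qed
  moreover have "exp (gamma_star * real N - f N) \<le> c N \<and> c N \<le> exp (gamma_star * real N + f N)" if "1 \<le> N" for N
  proof -
    have "0 < c N" using card_unit_fraction_sets_pos[OF that] by (simp add: c_def)
    then have "c N = exp (ln (c N))" by simp
    moreover have "exp (gamma_star * real N - f N) \<le> exp (ln (c N))" "exp (ln (c N)) \<le> exp (gamma_star * real N + f N)"
      by (simp_all add: f_def)
    ultimately show ?thesis by simp
  qed
  ultimately show ?thesis using ex1_lambda_star unfolding c_def by blast
qed

end
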